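(* Let $X$ be a spectrally extremal regular graph on $n$ vertices of diameter $d$, with distinct eigenvalues $\theta_0 > \dots > \theta_d$. Let $u,v$ be vertices at distance $d$. Then $u$ and $v$ are antipodal if and only if \[ n \prod_{s=0}^{d} \frac{1}{\theta_0 - \theta_s} = \sum_{r=0}^{d} (-1)^r \prod_{s \neq r} \frac{1}{\theta_r - \theta_s}, \] where in the left-hand product the factor with $s=0$ is omitted.
   Context: $X$ is a finite simple connected graph with adjacency matrix $A$. A graph of diameter $d$ has at least $d+1$ distinct eigenvalues; it is called spectrally extremal if it has exactly $d+1$. Write $A = \sum_r \theta_r E_r$ (spectral decomposition, $E_r$ orthogonal projection onto the $\theta_r$-eigenspace), $e_w$ the standard basis vector of $w$. Vertices $u,v$ are cospectral if $X\setminus u$ and $X\setminus v$ have the same adjacency spectrum. Let $\varphi$ be the positive eigenvector of $A$ for its largest eigenvalue and $D = \mathrm{diag}(\varphi)$. A partition of $V(X)$ is pseudo equitable if for each class $C$ and vertex $x$, $\sum_{y \in C}(D^{-1}AD)_{x,y}$ depends only on the class containing $x$ (for regular graphs this is the usual notion of an equitable partition). The distance partition of $u$ is the partition of $V(X)$ into the sets $\{w : d(u,w)=i\}$. Vertices $u$ and $v$ are antipodal if: there is a pseudo equitable partition that is simultaneously the distance partition of $u$ and of $v$; $\{u\}$ and $\{v\}$ are singleton classes of this partition at maximum distance from each other; and $u$ and $v$ are cospectral. *)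

theory Defs
  imports "Jordan_Normal_Form.Determinant" "Jordan_Normal_Form.Char_Poly"
begin

text \<open>Graphs on the vertex set {0..<n}; E is the (symmetric, irreflexive) adjacency relation.\<close>

definition simple_graph :: "nat \<Rightarrow> (nat \<Rightarrow> nat \<Rightarrow> bool) \<Rightarrow> bool" where
  "simple_graph n E \<longleftrightarrow> (\<forall>x y. E x y = E y x) \<and> (\<forall>x. \<not> E x x)"

definition adj_mat :: "nat \<Rightarrow> (nat \<Rightarrow> nat \<Rightarrow> bool) \<Rightarrow> real mat" where
  "adj_mat n E = mat n n (\<lambda>(i,j). if E i j then 1 else 0)"

definition edge_rel :: "nat \<Rightarrow> (nat \<Rightarrow> nat \<Rightarrow> bool) \<Rightarrow> (nat \<times> nat) set" where
  "edge_rel n E = {(x,y). x < n \<and> y < n \<and> E x y}"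

definition gdist :: "nat \<Rightarrow> (nat \<Rightarrow> nat \<Rightarrow> bool) \<Rightarrow> nat \<Rightarrow> nat \<Rightarrow> nat" where
  "gdist n E u w = (LEAST k. (u,w) \<in> edge_rel n E ^^ k)"

definition connected_graph :: "nat \<Rightarrow> (nat \<Rightarrow> nat \<Rightarrow> bool) \<Rightarrow> bool" where
  "connected_graph n E \<longleftrightarrow> 0 < n \<and> (\<forall>u<n. \<forall>w<n. \<exists>k. (u,w) \<in> edge_rel n E ^^ k)"

definition diameter :: "nat \<Rightarrow> (nat \<Rightarrow> nat \<Rightarrow> bool) \<Rightarrow> nat" where
  "diameter n E = Max {gdist n E u w | u w. u < n \<and> w < n}"

definition regular_graph :: "nat \<Rightarrow> (nat \<Rightarrow> nat \<Rightarrow> bool) \<Rightarrow> bool" where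
  "regular_graph n E \<longleftrightarrow> (\<exists>k. \<forall>x<n. card {y. y < n \<and> E x y} = k)"

definition adj_eigenvalues :: "nat \<Rightarrow> (nat \<Rightarrow> nat \<Rightarrow> bool) \<Rightarrow> real set" where
  "adj_eigenvalues n E = {t. eigenvalue (adj_mat n E) t}"

definition spectrally_extremal :: "nat \<Rightarrow> (nat \<Rightarrow> nat \<Rightarrow> bool) \<Rightarrow> bool" where
  "spectrally_extremal n E \<longleftrightarrow> card (adj_eigenvalues n E) = diameter n E + 1"

text \<open>Cospectral vertices: the vertex-deleted subgraphs have the same adjacency spectrum
  (with multiplicities), i.e. the same characteristic polynomial. The adjacency matrix of
  X minus u is the principal submatrix obtained by deleting row and column u.\<close>
definition cospectral :: "nat \<Rightarrow> (nat \<Rightarrow> nat \<Rightarrow> bool) \<Rightarrow> nat \<Rightarrow> nat \<Rightarrow> bool" where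
  "cospectral n E u v \<longleftrightarrow>
     char_poly (mat_delete (adj_mat n E) u u) = char_poly (mat_delete (adj_mat n E) v v)"

definition perron_vector :: "nat \<Rightarrow> (nat \<Rightarrow> nat \<Rightarrow> bool) \<Rightarrow> real vec \<Rightarrow> bool" where
  "perron_vector n E \<phi> \<longleftrightarrow>
     eigenvector (adj_mat n E) \<phi> (Max (adj_eigenvalues n E)) \<and> (\<forall>i<n. \<phi> $ i > 0)"

definition is_partition :: "nat \<Rightarrow> nat set set \<Rightarrow> bool" where
  "is_partition n P \<longleftrightarrow> \<Union>P = {0..<n} \<and> {} \<notin> P \<and>
     (\<forall>C\<in>P. \<forall>C'\<in>P. C \<noteq> C' \<longrightarrow> C \<inter> C' = {})"

text \<open>Pseudo equitable partition: (D^-1 A D)_{x,y} = A_{x,y} phi_y / phi_x.\<close>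
definition pseudo_equitable :: "nat \<Rightarrow> (nat \<Rightarrow> nat \<Rightarrow> bool) \<Rightarrow> nat set set \<Rightarrow> bool" where
  "pseudo_equitable n E P \<longleftrightarrow> is_partition n P \<and>
     (\<exists>\<phi>. perron_vector n E \<phi> \<and>
        (\<forall>C\<in>P. \<forall>C'\<in>P. \<forall>x\<in>C'. \<forall>x'\<in>C'.
           (\<Sum>y\<in>C. adj_mat n E $$ (x,y) * \<phi> $ y / \<phi> $ x)
         = (\<Sum>y\<in>C. adj_mat n E $$ (x',y) * \<phi> $ y / \<phi> $ x')))"

definition distance_partition :: "nat \<Rightarrow> (nat \<Rightarrow> nat \<Rightarrow> bool) \<Rightarrow> nat \<Rightarrow> nat set set" where
  "distance_partition n E u =
     {C. \<exists>i. C = {w. w < n \<and> gdist n E u w = i} \<and> C \<noteq> {}}"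

definition antipodal :: "nat \<Rightarrow> (nat \<Rightarrow> nat \<Rightarrow> bool) \<Rightarrow> nat \<Rightarrow> nat \<Rightarrow> bool" where
  "antipodal n E u v \<longleftrightarrow>
     (\<exists>P. pseudo_equitable n E P \<and> P = distance_partition n E u \<and> P = distance_partition n E v
        \<and> {u} \<in> P \<and> {v} \<in> P \<and> (\<forall>w<n. gdist n E u w \<le> gdist n E u v))
     \<and> cospectral n E u v"

end

(* Write A for the adjacency matrix and Q for the polynomial with Q(theta_r) = (-1)^r for all r.
   Lagrange interpolation expresses Q through polynomials of degree d. For a polynomial of degree at
   most d the (u,v) entry at A sees only the leading coefficient, because d(u,v) = d, and the Lagrange
   polynomial of theta_0 evaluates at A to J/n. Hence the equation says exactly that Q(A) has
   (u,v) entry 1; as Q(A)^2 = I, this means Q(A) e_u = e_v.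

   If Q(A) e_u = e_v, counting coefficients gives for every i <= d a nonzero f of degree at most i and
   a g of degree at most d - i with f = g Q on the spectrum. Then f(A) e_u = g(A) e_v is supported on
   the vertices at distance i from u and d - i from v. These vectors form a basis of the cyclic module
   of e_u, which contains the all-one vector and is invariant under A, so the distance classes of u
   are those of v in reverse order and form an equitable partition.

   Conversely, if the distance partition is equitable, the indicators of its classes lie in the cyclic
   module of e_u; in particular e_v = g(A) e_u. Cospectrality forces g = 1 or g = -1 at each
   eigenvalue, and the sign of g(theta_r) is that of the leading coefficient of the r-th Lagrange
   polynomial, which is (-1)^r. *)

theory Submission
  imports Defs "HOL-Computational_Algebra.Fundamental_Theorem_Algebra"
begin

section \<open>Real factors of real polynomials\<close>

text \<open>Take a complex root. If it is real, it splits off a linear factor. Otherwise it is a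
  root of a real quadratic \<open>q\<close>, and the remainder of \<open>p\<close> modulo
  \<open>q\<close>, a real polynomial of degree at most 1 with a non-real root, must be 0.\<close>

lemma real_poly_complex_root_cases:
  fixes p :: "real poly"
  assumes "degree p > 0"
  obtains z r where "p = [:- z, 1:] * r"
  | a b r where "b \<noteq> 0" "p = [:a\<^sup>2 + b\<^sup>2, - 2 * a, 1:] * r"
proof -
  interpret mp: map_poly_inj_idom_hom complex_of_real ..
  let ?P = "map_poly complex_of_real p"
  have "degree ?P > 0" using assms by simp
  then have "\<not> constant (poly ?P)" by (simp add: constant_degree)
  then obtain z where z: "poly ?P z = 0"
    using fundamental_theorem_of_algebra by blast
  show ?thesis
  proof (cases "Im z = 0")
    case True
    then have "z = complex_of_real (Re z)" by (simp add: complex_eq_iff)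
    then have "complex_of_real (poly p (Re z)) = 0"
      using z by (metis of_real_hom.poly_map_poly)
    then have "poly p (Re z) = 0" by simp
    then show ?thesis using that(1) by (metis dvdE poly_eq_0_iff_dvd)
  next
    case False
    define a b where "a = Re z" "b = Im z"
    define q where "q = [:a\<^sup>2 + b\<^sup>2, - 2 * a, 1:]"
    have qz: "poly (map_poly complex_of_real q) z = 0"
      by (simp add: q_def a_b_def complex_eq_iff power2_eq_square algebra_simps)
    have dq: "degree q = 2" "q \<noteq> 0" by (simp_all add: q_def)
    have "poly (map_poly complex_of_real (p mod q)) z = 0"
    proof -
      have "?P = map_poly complex_of_real (q * (p div q) + p mod q)" by simp
      also have "\<dots> = map_poly complex_of_real q * map_poly complex_of_real (p div q)
          + map_poly complex_of_real (p mod q)"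
        by (simp only: mp.hom_add mp.hom_mult)
      finally show ?thesis using z qz by simp
    qed
    moreover obtain c e where ce: "p mod q = [:c, e:]"
    proof -
      have "degree (p mod q) \<le> 1"
        using degree_mod_less[of q p] dq by auto
      then show ?thesis using that
        by (metis degree_0_id degree_pCons_eq_if pCons_cases diff_Suc_1 le_Suc_eq le_zero_eq
            One_nat_def old.nat.inject degree_eq_zeroE pCons_0_0)
    qed
    ultimately have "complex_of_real c + complex_of_real e * z = 0"
      by (simp add: of_real_hom.map_poly_pCons_hom mult.commute)
    then have "e = 0" "c = 0" using False by (auto simp: complex_eq_iff)
    then have "q dvd p" using ce by (simp add: mod_eq_0_iff_dvd)
    then show ?thesis using that(2)[of b a] False by (auto simp: q_def a_b_def elim: dvdE)
  qed
qed

section \<open>Polynomials in a real symmetric operator\<close>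

locale sym_matrix =
  fixes n :: nat and a :: "nat \<Rightarrow> nat \<Rightarrow> real"
  assumes sym: "a x y = a y x"
begin

text \<open>The matrix acts on functions instead of vectors with a carrier, which avoids dimension
  conditions. The value 0 from \<open>n\<close> on makes every image satisfy \<open>supp\<close>, so
  that vectors can be compared as functions.\<close>

definition T :: "(nat \<Rightarrow> real) \<Rightarrow> nat \<Rightarrow> real" where
  "T x i = (if i < n then \<Sum>j<n. a i j * x j else 0)"

definition papp :: "real poly \<Rightarrow> (nat \<Rightarrow> real) \<Rightarrow> nat \<Rightarrow> real" where
  "papp p x i = (\<Sum>k\<le>degree p. coeff p k * (T ^^ k) x i)"

definition dot :: "(nat \<Rightarrow> real) \<Rightarrow> (nat \<Rightarrow> real) \<Rightarrow> real" where
  "dot x y = (\<Sum>i<n. x i * y i)"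

definition supp :: "(nat \<Rightarrow> real) \<Rightarrow> bool" where
  "supp x \<longleftrightarrow> (\<forall>i\<ge>n. x i = 0)"

definition std_basis :: "nat \<Rightarrow> nat \<Rightarrow> real" where
  "std_basis u i = (if i = u then 1 else 0)"

definition eig :: "real \<Rightarrow> bool" where
  "eig t \<longleftrightarrow> (\<exists>x. supp x \<and> x \<noteq> (\<lambda>i. 0) \<and> T x = (\<lambda>i. t * x i))"

lemma T_add: "T (\<lambda>i. x i + y i) i = T x i + T y i"
  by (simp add: T_def algebra_simps sum.distrib)

lemma T_scale: "T (\<lambda>i. c * x i) i = c * T x i"
  by (simp add: T_def algebra_simps sum_distrib_left)

lemma T_zero [simp]: "T (\<lambda>i. 0) i = 0"
  by (simp add: T_def)

lemma T_sum: "T (\<lambda>i. \<Sum>k\<in>K. f k i) i = (\<Sum>k\<in>K. T (f k) i)"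
proof (induction K rule: infinite_finite_induct)
  case (insert k K)
  then show ?case using T_add[of "f k" "\<lambda>i. \<Sum>k\<in>K. f k i"] by simp
qed auto

lemma papp_alt:
  assumes "degree p \<le> N"
  shows "papp p x i = (\<Sum>k\<le>N. coeff p k * (T ^^ k) x i)"
  unfolding papp_def
  by (rule sum.mono_neutral_left) (use assms in \<open>auto simp: not_le coeff_eq_0\<close>)

lemma papp_0 [simp]: "papp 0 x i = 0"
  by (simp add: papp_def)

lemma papp_pCons: "papp (pCons c p) x i = c * x i + T (papp p x) i"
proof -
  have "papp (pCons c p) x i = (\<Sum>k\<le>Suc (degree p). coeff (pCons c p) k * (T ^^ k) x i)"
    by (rule papp_alt) (simp add: degree_pCons_le)
  also have "\<dots> = c * x i + (\<Sum>k\<le>degree p. coeff p k * T ((T ^^ k) x) i)"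
    by (subst sum.atMost_Suc_shift) simp
  also have "(\<Sum>k\<le>degree p. coeff p k * T ((T ^^ k) x) i) = T (papp p x) i"
    unfolding papp_def T_sum T_scale ..
  finally show ?thesis .
qed

lemma papp_1 [simp]: "papp 1 x i = x i"
  by (simp add: one_pCons papp_pCons fun_eq_iff T_def)

lemma papp_const: "papp [:c:] x i = c * x i"
  by (simp add: papp_pCons fun_eq_iff T_def)

lemma papp_add: "papp (p + q) x i = papp p x i + papp q x i"
proof (induction p q arbitrary: i rule: poly_induct2)
  case (pCons c p d q)
  have "papp (p + q) x = (\<lambda>i. papp p x i + papp q x i)" using pCons by auto
  then show ?case by (simp add: papp_pCons T_add algebra_simps)
qed simp

lemma papp_smult: "papp (Polynomial.smult c p) x i = c * papp p x i"
proof (induction p arbitrary: i)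
  case (pCons d p)
  have "papp (Polynomial.smult c p) x = (\<lambda>i. c * papp p x i)" using pCons by auto
  then show ?case by (simp add: papp_pCons T_scale algebra_simps)
qed simp

lemma papp_diff: "papp (p - q) x i = papp p x i - papp q x i"
  using papp_add[of p "Polynomial.smult (-1) q" x i] unfolding papp_smult by simp

lemma papp_sum: "papp (\<Sum>k\<in>K. f k) x i = (\<Sum>k\<in>K. papp (f k) x i)"
  by (induction K rule: infinite_finite_induct) (auto simp: papp_add)

lemma papp_mult: "papp (p * q) x = papp p (papp q x)"
proof (induction p)
  case (pCons c p)
  show ?case
    by (rule ext) (simp add: mult_pCons_left papp_add papp_smult papp_pCons pCons)
qed auto

lemma papp_vec_zero [simp]: "papp p (\<lambda>i. 0) i = 0"
proof (induction p arbitrary: i)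
  case (pCons c p)
  then have "papp p (\<lambda>i. 0) = (\<lambda>i. 0)" by auto
  then show ?case by (simp add: papp_pCons)
qed simp

lemma papp_linear: "papp [:- t, 1:] x i = T x i - t * x i"
  by (simp add: papp_pCons fun_eq_iff[symmetric] papp_const[abs_def] one_pCons[symmetric])
     (simp add: T_def)

lemma papp_eigen:
  assumes "T x = (\<lambda>i. t * x i)"
  shows "papp p x i = poly p t * x i"
proof (induction p arbitrary: i)
  case (pCons c p)
  have "papp p x = (\<lambda>i. poly p t * x i)" using pCons by auto
  then show ?case by (simp add: papp_pCons T_scale assms distrib_right)
qed simp

lemma supp_e: "u < n \<Longrightarrow> supp (std_basis u)"
  by (simp add: supp_def std_basis_def)

lemma supp_papp: "supp x \<Longrightarrow> supp (papp p x)"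
  by (induction p) (auto simp: supp_def papp_pCons T_def)

lemma dot_commute: "dot x y = dot y x"
  by (simp add: dot_def mult.commute)

lemma dot_T: "dot (T x) y = dot x (T y)"
proof -
  have "dot (T x) y = (\<Sum>i<n. \<Sum>j<n. a i j * x j * y i)"
    by (simp add: dot_def T_def sum_distrib_right)
  also have "\<dots> = (\<Sum>j<n. \<Sum>i<n. a i j * x j * y i)"
    by (rule sum.swap)
  also have "\<dots> = dot x (T y)"
    by (simp add: dot_def T_def sum_distrib_left) (intro sum.cong refl, simp add: sym mult_ac)
  finally show ?thesis .
qed

lemma dot_add: "dot (\<lambda>i. x i + y i) z = dot x z + dot y z"
  by (simp add: dot_def algebra_simps sum.distrib)

lemma dot_scale: "dot (\<lambda>i. c * x i) z = c * dot x z"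
  by (simp add: dot_def algebra_simps sum_distrib_left)

lemma dot_papp: "dot (papp p x) y = dot x (papp p y)"
proof (induction p arbitrary: x y)
  case (pCons c p)
  have *: "papp (pCons c p) z = (\<lambda>i. c * z i + T (papp p z) i)" for z
    by (rule ext) (rule papp_pCons)
  have c: "papp p (T z) = T (papp p z)" for z
    using papp_mult[of p "[:0,1:]" z] papp_mult[of "[:0,1:]" p z]
    by (simp add: papp_linear[of 0, simplified, abs_def] mult.commute)
  have "dot (papp (pCons c p) x) y = c * dot x y + dot (papp p x) (T y)"
    by (simp add: * dot_add dot_scale dot_T)
  also have "\<dots> = c * dot y x + dot (T (papp p y)) x"
    by (simp only: pCons c dot_commute[of x])
  finally show ?case by (simp add: * dot_add dot_scale dot_commute[of x])
qed (simp add: dot_def)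

lemma dot_self_eq_0:
  assumes x: "supp x"
  shows "dot x x = 0 \<longleftrightarrow> x = (\<lambda>i. 0)"
proof
  assume "dot x x = 0"
  then have "\<forall>i\<in>{..<n}. x i * x i = 0"
    unfolding dot_def by (subst (asm) sum_nonneg_eq_0_iff) auto
  then have "x i = 0" if "i < n" for i using that by simp
  then show "x = (\<lambda>i. 0)" using x by (auto simp: supp_def fun_eq_iff not_le[symmetric])
qed (simp add: dot_def)

lemma dot_self_nonneg: "dot x x \<ge> 0"
  by (simp add: dot_def sum_nonneg)

lemma dot_e: "u < n \<Longrightarrow> dot (std_basis u) x = x u"
  by (simp add: dot_def std_basis_def if_distrib[of "\<lambda>z. z * _"] sum.delta cong: if_cong)

text \<open>By symmetry the squared norm of \<open>papp q y\<close> is the inner product of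
  \<open>y\<close> with \<open>papp (q * q) y\<close>. This is what removes multiple roots from an
  annihilator.\<close>

lemma papp_square_eq_0:
  assumes "supp y" "papp (q * q) y = (\<lambda>i. 0)"
  shows "papp q y = (\<lambda>i. 0)"
proof -
  have "dot (papp q y) (papp q y) = dot y (papp (q * q) y)"
    by (simp add: dot_papp papp_mult)
  also have "\<dots> = 0" by (simp add: assms dot_def)
  finally show ?thesis using dot_self_eq_0 supp_papp assms by blast
qed

text \<open>Symmetry makes the operator semisimple: an annihilator of \<open>y\<close> may be stripped of its non-real
  roots, of the real roots that are not eigenvalues, and of multiplicities.\<close>

lemma annihilator_reduce:
  assumes "finite S" "\<And>t. eig t \<Longrightarrow> t \<in> S"
    and "p \<noteq> 0" "supp y" "papp p y = (\<lambda>i. 0)"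
  shows "papp (\<Prod>t\<in>S. [:- t, 1:]) y = (\<lambda>i. 0)"
  using assms(3-5)
proof (induction "degree p" arbitrary: p y rule: less_induct)
  case less
  show ?case
  proof (cases "degree p = 0")
    case True
    then obtain c where c: "p = [:c:]" by (rule degree_eq_zeroE)
    then have "y = (\<lambda>i. 0)" using less.prems by (auto simp: papp_const[abs_def] fun_eq_iff)
    then show ?thesis by auto
  next
    case False
    then have "degree p > 0" by simp
    then show ?thesis
    proof (cases rule: real_poly_complex_root_cases)
      case (1 z r)
      have "r \<noteq> 0" using 1 less.prems by auto
      then have deg: "degree r < degree p" using degree_mult_eq[of "[:- z, 1:]" r] 1 by (simp del: mult_pCons_left)
      show ?thesis
      proof (cases "z \<in> S")
        case False
        let ?y = "papp r y"
        have "papp [:- z, 1:] ?y = (\<lambda>i. 0)" using less.prems(3) unfolding 1 papp_mult .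
        then have "T ?y = (\<lambda>i. z * ?y i)" by (simp add: fun_eq_iff papp_linear)
        then have "?y = (\<lambda>i. 0)" using False assms(2) supp_papp[OF less.prems(2)]
          unfolding eig_def by blast
        then show ?thesis using less.hyps[OF deg \<open>r \<noteq> 0\<close> less.prems(2)] by simp
      next
        case True
        let ?m = "\<Prod>t\<in>S - {z}. [:- t, 1:]"
        have m: "(\<Prod>t\<in>S. [:- t, 1:]) = [:- z, 1:] * ?m"
          using True assms(1) by (simp add: prod.remove)
        \<comment> \<open>The induction hypothesis is applied to (A - z)\<open>y\<close>, which
          \<open>r\<close> annihilates. The factor A - z then occurs twice, and
          \<open>papp_square_eq_0\<close> removes one copy.\<close>
        let ?y = "papp [:- z, 1:] y"
        have "p = r * [:- z, 1:]" using 1 by (simp only: mult.commute)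
        with less.prems(3) have "papp r ?y = (\<lambda>i. 0)" by (simp only: papp_mult)
        then have "papp ([:- z, 1:] * ?m) ?y = (\<lambda>i. 0)"
          using less.hyps[OF deg \<open>r \<noteq> 0\<close> supp_papp[OF less.prems(2)]] m by simp
        then have "papp ([:- z, 1:] * [:- z, 1:]) (papp ?m y) = (\<lambda>i. 0)"
          by (simp only: papp_mult[symmetric] mult_ac)
        then have "papp [:- z, 1:] (papp ?m y) = (\<lambda>i. 0)"
          using papp_square_eq_0 supp_papp[OF less.prems(2)] by blast
        then show ?thesis by (simp only: m papp_mult)
      qed
    next
      case (2 c b r)
      have "r \<noteq> 0" using 2 less.prems by auto
      then have deg: "degree r < degree p" using degree_mult_eq[of "[:c\<^sup>2 + b\<^sup>2, - 2 * c, 1:]" r] 2 by (simp del: mult_pCons_left)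
      let ?y = "papp r y"
      have sy: "supp ?y" using supp_papp less.prems by blast
      have "[:c\<^sup>2 + b\<^sup>2, - 2 * c, 1:] = [:- c, 1:] * [:- c, 1:] + [:b\<^sup>2:]"
        by (simp add: power2_eq_square)
      then have "papp ([:- c, 1:] * [:- c, 1:] + [:b\<^sup>2:]) ?y = (\<lambda>i. 0)"
        using less.prems(3) 2(2) by (simp only: papp_mult)
      then have "(\<lambda>i. papp ([:- c, 1:] * [:- c, 1:]) ?y i + b\<^sup>2 * ?y i) = (\<lambda>i. 0)"
        by (auto simp only: papp_add papp_const fun_eq_iff)
      \<comment> \<open>Pairing with \<open>?y\<close> turns the quadratic factor into the sum of
        the squared norm of (A - \<open>c\<close>)\<open>?y\<close> and \<open>b\<^sup>2\<close>
        times that of \<open>?y\<close>. Both are nonnegative, so \<open>?y\<close> vanishes because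
        \<open>b\<close> is nonzero.\<close>
      then have "0 = dot (\<lambda>i. papp ([:- c, 1:] * [:- c, 1:]) ?y i + b\<^sup>2 * ?y i) ?y"
        by (simp only:) (simp add: dot_def)
      also have "\<dots> = dot (papp [:- c, 1:] ?y) (papp [:- c, 1:] ?y) + b\<^sup>2 * dot ?y ?y"
        by (simp only: dot_add dot_scale papp_mult dot_papp)
      finally have "b\<^sup>2 * dot ?y ?y = 0"
        using dot_self_nonneg[of "papp [:- c, 1:] ?y"]
          mult_nonneg_nonneg[OF zero_le_power2[of b] dot_self_nonneg[of ?y]] by linarith
      then have "?y = (\<lambda>i. 0)" using 2 dot_self_eq_0[OF sy] by simp
      then show ?thesis using less.hyps[OF deg \<open>r \<noteq> 0\<close> less.prems(2)] by simp
    qed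
  qed
qed

end

section \<open>The adjugate, the Cayley-Hamilton theorem and cospectral vertices\<close>

lemma char_poly_mat_delete_cofactor:
  assumes "A \<in> carrier_mat n n" "u < n"
  shows "cofactor (char_poly_matrix A) u u = char_poly (mat_delete A u u)"
proof -
  have "mat_delete (char_poly_matrix A) u u = char_poly_matrix (mat_delete A u u)"
    by (rule eq_matI)
       (use assms in \<open>auto simp: mat_delete_def char_poly_matrix_def\<close>)
  then show ?thesis by (simp add: cofactor_def char_poly_def power_add[symmetric])
qed

context sym_matrix
begin

abbreviation M :: "real mat" where
  "M \<equiv> mat n n (\<lambda>(i, j). a i j)"

text \<open>Comparing coefficients of \<open>t\<close> in \<open>(t I - A) adj (t I - A) = \<chi>(t) I\<close> identifies the coefficients
  of the adjugate as polynomials in \<open>A\<close>. This yields both the Cayley-Hamilton theorem and, on the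
  diagonal, the characteristic polynomials of the vertex-deleted subgraphs.\<close>

lemma adjugate_eq:
  assumes "y < n" "x < n"
  shows "pCons 0 (cofactor (char_poly_matrix M) y x)
    = (\<Sum>z<n. Polynomial.smult (a x z) (cofactor (char_poly_matrix M) y z))
      + [:std_basis y x:] * char_poly M"
proof -
  let ?C = "char_poly_matrix M" and ?f = "\<lambda>z. cofactor (char_poly_matrix M) y z"
  have C: "?C \<in> carrier_mat n n" by simp
  have "(?C * Determinant.adj_mat ?C) $$ (x, y) = (char_poly M \<cdot>\<^sub>m 1\<^sub>m n) $$ (x, y)"
    using adj_mat(2)[OF C] by (simp add: char_poly_def)
  moreover have "(?C * Determinant.adj_mat ?C) $$ (x, y) = (\<Sum>z<n. ?C $$ (x, z) * ?f z)"
    using assms carrier_matD[OF C]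
    by (simp add: Determinant.adj_mat_def scalar_prod_def atLeast0LessThan)
  moreover have "?C $$ (x, z) = (if z = x then [:0, 1:] else 0) - [:a x z:]" if "z < n" for z
    using assms that by (auto simp: char_poly_matrix_def)
  ultimately have "(\<Sum>z<n. ((if z = x then [:0, 1:] else 0) - [:a x z:]) * ?f z) = [:std_basis y x:] * char_poly M"
    using assms by (simp add: std_basis_def)
  moreover have "(\<Sum>z<n. ((if z = x then [:0, 1:] else 0) - [:a x z:]) * ?f z)
     = (\<Sum>z<n. if z = x then pCons 0 (?f z) else 0) - (\<Sum>z<n. Polynomial.smult (a x z) (?f z))"
    unfolding sum_subtractf[symmetric] by (intro sum.cong) (auto simp: algebra_simps)
  ultimately show ?thesis using assms by (simp add: sum.delta algebra_simps)
qed

text \<open>Comparing coefficients of t^(k+1) in \<open>adjugate_eq\<close> expresses coefficient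
  \<open>k\<close> of the adjugate as A times coefficient k+1, plus a coefficient of the
  characteristic polynomial. This is the Horner recursion satisfied by the shifted characteristic
  polynomials evaluated at A.\<close>

lemma cofactor_coeff:
  assumes "y < n" "x < n"
  shows "coeff (cofactor (char_poly_matrix M) y x) k
    = papp (poly_shift (Suc k) (char_poly M)) (std_basis y) x"
proof -
  let ?f = "\<lambda>z. cofactor (char_poly_matrix M) y z" and ?p = "char_poly M"
  have shift: "poly_shift k q = pCons (coeff q k) (poly_shift (Suc k) q)" for k and q :: "real poly"
    by (rule poly_eqI) (auto simp: coeff_poly_shift coeff_pCons split: nat.splits)
  define N where "N = Max (insert (degree ?p) ((\<lambda>z. degree (?f z)) ` {..<n}))"
  have N: "degree ?p \<le> N" "z < n \<Longrightarrow> degree (?f z) \<le> N" for z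
    unfolding N_def by (auto intro!: Max_ge)
  \<comment> \<open>Downward induction on the exponent \<open>N + 1 - j\<close>, starting above all
    degrees, where both sides are 0. Once the exponent has reached 0, truncated subtraction keeps it
    there.\<close>
  have "coeff (?f x) (N + 1 - j) = papp (poly_shift (Suc (N + 1 - j)) ?p) (std_basis y) x" if "x < n" for x j
    using that
  proof (induction j arbitrary: x)
    case 0
    then have "coeff (?f x) (N + 1) = 0" using N(2)[of x] by (intro coeff_eq_0) simp
    moreover have "poly_shift (Suc (N + 1)) ?p = 0"
      by (rule poly_eqI) (use N(1) in \<open>simp add: coeff_poly_shift coeff_eq_0\<close>)
    ultimately show ?case by simp
  next
    case (Suc j)
    show ?case
    proof (cases "j \<le> N")
      case True
      define k where "k = N - j"
      have k: "N + 1 - j = Suc k" "N + 1 - Suc j = k" using True by (auto simp: k_def)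
      have "coeff (?f x) k = coeff (pCons 0 (?f x)) (Suc k)" by simp
      also have "\<dots> = (\<Sum>z<n. a x z * coeff (?f z) (Suc k)) + std_basis y x * coeff ?p (Suc k)"
        unfolding adjugate_eq[OF assms(1) Suc.prems] by (simp add: coeff_sum)
      also have "\<dots> = (\<Sum>z<n. a x z * papp (poly_shift (Suc (Suc k)) ?p) (std_basis y) z)
          + std_basis y x * coeff ?p (Suc k)"
        using Suc.IH k by simp
      also have "\<dots> = papp (poly_shift (Suc k) ?p) (std_basis y) x"
        unfolding shift[of "Suc k"] papp_pCons using Suc.prems by (simp add: T_def)
      finally show ?thesis using k by simp
    next
      case False
      then show ?thesis using Suc by simp
    qed
  qed
  note * = this
  show ?thesis
  proof (cases "k \<le> N + 1")
    case True
    then show ?thesis using *[OF assms(2), of "N + 1 - k"] by simp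
  next
    case False
    then have "coeff (?f x) k = 0" using N(2)[of x] assms by (intro coeff_eq_0) simp
    moreover have "poly_shift (Suc k) ?p = 0"
      by (rule poly_eqI) (use N(1) False in \<open>simp add: coeff_poly_shift coeff_eq_0\<close>)
    ultimately show ?thesis by simp
  qed
qed

lemma degree_char_poly_M: "degree (char_poly M) = n" "coeff (char_poly M) n = 1"
  using degree_monic_char_poly[of M n] by auto

text \<open>The same comparison at t^0: the left-hand side of \<open>adjugate_eq\<close> has
  constant coefficient 0, while the right-hand side yields the full characteristic polynomial at
  A.\<close>

lemma cayley_hamilton:
  assumes "y < n"
  shows "papp (char_poly M) (std_basis y) = (\<lambda>i. 0)"
proof
  fix x
  show "papp (char_poly M) (std_basis y) x = 0"
  proof (cases "x < n")
    case True
    let ?f = "\<lambda>z. cofactor (char_poly_matrix M) y z" and ?p = "char_poly M"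
    have "0 = coeff (pCons 0 (?f x)) 0" by simp
    also have "\<dots> = (\<Sum>z<n. a x z * coeff (?f z) 0) + std_basis y x * coeff ?p 0"
      unfolding adjugate_eq[OF assms True] by (simp add: coeff_sum)
    also have "\<dots> = papp (pCons (coeff ?p 0) (poly_shift 1 ?p)) (std_basis y) x"
      using True assms by (simp add: papp_pCons T_def cofactor_coeff)
    also have "pCons (coeff ?p 0) (poly_shift 1 ?p) = ?p"
      by (rule poly_eqI) (auto simp: coeff_poly_shift coeff_pCons split: nat.splits)
    finally show ?thesis by simp
  next
    case False
    then show ?thesis using supp_papp[OF supp_e[OF assms]] by (simp add: supp_def)
  qed
qed

text \<open>The deleted characteristic polynomials are diagonal cofactors, so their coefficients are
  diagonal entries of the shifts of the characteristic polynomial at A. These shifts span the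
  polynomials of degree below \<open>n\<close>, and Cayley-Hamilton reduces every polynomial to such
  a one.\<close>

lemma cospectral_iff_papp:
  assumes "u < n" "v < n"
  shows "char_poly (mat_delete M u u) = char_poly (mat_delete M v v)
    \<longleftrightarrow> (\<forall>p. papp p (std_basis u) u = papp p (std_basis v) v)"
proof -
  have c: "char_poly (mat_delete M w w) = cofactor (char_poly_matrix M) w w" if "w < n" for w
    using char_poly_mat_delete_cofactor[of M n w] that by simp
  let ?p = "char_poly M"
  show ?thesis
  proof
    assume "char_poly (mat_delete M u u) = char_poly (mat_delete M v v)"
    then have *: "papp (poly_shift (Suc k) ?p) (std_basis u) u = papp (poly_shift (Suc k) ?p) (std_basis v) v" for k
      using assms c cofactor_coeff by metis
    have low: "papp q (std_basis u) u = papp q (std_basis v) v" if "degree q < n" for q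
      using that
    proof (induction "degree q" arbitrary: q rule: less_induct)
      case less
      \<comment> \<open>This shift is monic of the same degree as \<open>q\<close>, so subtracting a
        multiple of it cancels the leading term of \<open>q\<close>.\<close>
      let ?s = "poly_shift (Suc (n - Suc (degree q))) ?p"
      have cs: "coeff ?s i = coeff ?p (i + (n - degree q))" for i
        using less.prems by (simp add: coeff_poly_shift Suc_diff_Suc)
      define r where "r = q - Polynomial.smult (lead_coeff q) ?s"
      have q: "q = r + Polynomial.smult (lead_coeff q) ?s" by (simp add: r_def)
      have r0: "coeff r i = 0" if "i \<ge> degree q" for i
      proof (cases "i = degree q")
        case True
        then show ?thesis using less.prems degree_char_poly_M by (simp add: r_def cs)
      next
        case False
        then show ?thesis using that less.prems degree_char_poly_M(1)
          by (simp add: r_def cs coeff_eq_0)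
      qed
      have "papp r (std_basis u) u = papp r (std_basis v) v"
      proof (cases "r = 0")
        case False
        then have "degree r < degree q" using r0 leading_coeff_0_iff not_less by blast
        then show ?thesis using less by simp
      qed simp
      then show ?case using * by (subst (1 2) q) (simp add: papp_add papp_smult)
    qed
    show "\<forall>q. papp q (std_basis u) u = papp q (std_basis v) v"
    proof
      fix q
      have "degree (q mod ?p) < n"
      proof -
        have "?p \<noteq> 0" using degree_char_poly_M by auto
        then show ?thesis using degree_mod_less[of ?p q] degree_char_poly_M(1) assms by auto
      qed
      moreover have "papp q (std_basis w) = papp (q mod ?p) (std_basis w)" if "w < n" for w
      proof -
        have "papp (q div ?p * ?p + q mod ?p) (std_basis w) i = papp (q mod ?p) (std_basis w) i" for i
          using cayley_hamilton[OF that] by (simp only: papp_add papp_mult) simp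
        then show ?thesis by (simp add: fun_eq_iff)
      qed
      ultimately show "papp q (std_basis u) u = papp q (std_basis v) v" using low assms by simp
    qed
  next
    assume "\<forall>p. papp p (std_basis u) u = papp p (std_basis v) v"
    then show "char_poly (mat_delete M u u) = char_poly (mat_delete M v v)"
      using assms by (simp add: c poly_eq_iff cofactor_coeff)
  qed
qed

end

section \<open>Walks and distances in a connected graph\<close>

locale conn_graph =
  fixes n :: nat and E :: "nat \<Rightarrow> nat \<Rightarrow> bool"
  assumes simple: "simple_graph n E" and connected: "connected_graph n E"

sublocale conn_graph \<subseteq> sym_matrix n "\<lambda>x y. if E x y then 1 else 0"
  by unfold_locales (use simple in \<open>simp add: simple_graph_def\<close>)

context conn_graph
begin

abbreviation "R \<equiv> edge_rel n E"
abbreviation "dst \<equiv> gdist n E"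
abbreviation "d \<equiv> diameter n E"

lemma n_pos: "0 < n"
  using connected by (simp add: connected_graph_def)

lemma adj_mat_M: "Defs.adj_mat n E = M"
  by (simp add: Defs.adj_mat_def)

lemma E_sym: "E x y \<Longrightarrow> E y x"
  using simple by (simp add: simple_graph_def)

lemma T_pow_e_nonneg: "0 \<le> (T ^^ k) (std_basis u) w"
  by (induction k arbitrary: w) (auto simp: std_basis_def T_def intro!: sum_nonneg)

text \<open>The entry is the number of walks of length \<open>k\<close> from \<open>u\<close> to
  \<open>w\<close>. As a sum of nonnegative terms it is positive once one term is nonzero.\<close>

lemma T_pow_e_pos_iff:
  assumes "u < n" "w < n"
  shows "0 < (T ^^ k) (std_basis u) w \<longleftrightarrow> (u, w) \<in> R ^^ k"
  using assms(2)
proof (induction k arbitrary: w)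
  case 0
  then show ?case by (auto simp: std_basis_def)
next
  case (Suc k)
  let ?f = "\<lambda>j. (if E w j then 1 else 0) * (T ^^ k) (std_basis u) j"
  have nn: "\<And>j. j \<in> {..<n} \<Longrightarrow> 0 \<le> ?f j" using T_pow_e_nonneg by simp
  have "(T ^^ Suc k) (std_basis u) w = sum ?f {..<n}" using Suc.prems by (simp add: T_def)
  then have "0 < (T ^^ Suc k) (std_basis u) w \<longleftrightarrow> sum ?f {..<n} \<noteq> 0"
    using sum_nonneg[OF nn] by force
  also have "\<dots> \<longleftrightarrow> (\<exists>j<n. ?f j \<noteq> 0)"
    using sum_nonneg_eq_0_iff[OF finite_lessThan nn] by auto
  also have "\<dots> \<longleftrightarrow> (\<exists>j<n. E w j \<and> 0 < (T ^^ k) (std_basis u) j)"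
    using T_pow_e_nonneg by (auto simp: less_le)
  also have "\<dots> \<longleftrightarrow> (\<exists>j<n. E w j \<and> (u, j) \<in> R ^^ k)"
    using Suc.IH by auto
  also have "\<dots> \<longleftrightarrow> (u, w) \<in> R ^^ Suc k"
    using Suc.prems E_sym unfolding edge_rel_def by auto
  finally show ?case .
qed

lemma gdist_walk: "u < n \<Longrightarrow> w < n \<Longrightarrow> (u, w) \<in> R ^^ dst u w"
  unfolding gdist_def using connected by (auto simp: connected_graph_def intro: LeastI_ex)

lemma gdist_le: "(u, w) \<in> R ^^ k \<Longrightarrow> dst u w \<le> k"
  unfolding gdist_def by (rule Least_le)

lemma gdist_self [simp]: "dst u u = 0"
  using gdist_le[of u u 0] by simp

lemma gdist_eq_0: "u < n \<Longrightarrow> w < n \<Longrightarrow> dst u w = 0 \<longleftrightarrow> u = w"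
  using gdist_walk[of u w] by auto

lemma walk_sym: "(u, w) \<in> R ^^ k \<Longrightarrow> (w, u) \<in> R ^^ k"
proof (induction k arbitrary: w)
  case (Suc k)
  then obtain y where y: "(u, y) \<in> R ^^ k" "(y, w) \<in> R" by auto
  then have "(w, y) \<in> R" using E_sym by (auto simp: edge_rel_def)
  then show ?case using Suc.IH[OF y(1)] by (rule relpow_Suc_I2)
qed simp

lemma gdist_sym: "u < n \<Longrightarrow> w < n \<Longrightarrow> dst u w = dst w u"
  by (meson gdist_le gdist_walk walk_sym le_antisym)

lemma gdist_triangle:
  assumes "u < n" "w < n" "x < n"
  shows "dst u w \<le> dst u x + dst x w"
  by (rule gdist_le) (auto simp: relpow_add intro: gdist_walk assms)

lemma gdist_le_diameter:
  assumes "u < n" "w < n"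
  shows "dst u w \<le> d"
proof -
  have "{dst u w | u w. u < n \<and> w < n} = (\<lambda>(u, w). dst u w) ` ({..<n} \<times> {..<n})"
    by auto
  then have "finite {dst u w | u w. u < n \<and> w < n}" by simp
  then show ?thesis unfolding diameter_def by (rule Max_ge) (use assms in blast)
qed

text \<open>Cut a shortest walk from \<open>u\<close> to \<open>v\<close> after \<open>j\<close>
  steps; by the triangle inequality no shorter walk reaches the cut vertex.\<close>

lemma ex_at_distance:
  assumes "u < n" "v < n" "j \<le> dst u v"
  obtains w where "w < n" "dst u w = j"
proof -
  have "(u, v) \<in> R ^^ (j + (dst u v - j))" using gdist_walk assms by simp
  then obtain w where w: "(u, w) \<in> R ^^ j" "(w, v) \<in> R ^^ (dst u v - j)"
    by (auto simp: relpow_add)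
  have "w < n"
    using w(1) assms(1) by (cases j) (auto simp: edge_rel_def)
  moreover have "dst u v \<le> dst u w + (dst u v - j)"
    using gdist_triangle[OF assms(1,2) \<open>w < n\<close>] gdist_le[OF w(2)] by simp
  ultimately show ?thesis using that gdist_le[OF w(1)] assms(3) by force
qed

lemma T_pow_e_eq_0: "u < n \<Longrightarrow> w < n \<Longrightarrow> k < dst u w \<Longrightarrow> (T ^^ k) (std_basis u) w = 0"
  using T_pow_e_pos_iff[of u w k] T_pow_e_nonneg[of k u w] gdist_le[of u w k] by force

lemma T_pow_e_gdist_pos: "u < n \<Longrightarrow> w < n \<Longrightarrow> 0 < (T ^^ dst u w) (std_basis u) w"
  using T_pow_e_pos_iff gdist_walk by simp

text \<open>No walk is shorter than the distance, so only the term of degree \<open>dst u w\<close>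
  can contribute. Applied at distance \<open>d\<close>, this reduces an entry of a polynomial in A
  to its leading coefficient.\<close>

lemma papp_e_at_distance:
  assumes "u < n" "w < n" "degree p \<le> dst u w"
  shows "papp p (std_basis u) w = coeff p (dst u w) * (T ^^ dst u w) (std_basis u) w"
proof -
  have "papp p (std_basis u) w = (\<Sum>k\<le>dst u w. coeff p k * (T ^^ k) (std_basis u) w)"
    using assms by (intro papp_alt)
  also have "\<dots> = (\<Sum>k\<in>{dst u w}. coeff p k * (T ^^ k) (std_basis u) w)"
    by (rule sum.mono_neutral_right) (use assms T_pow_e_eq_0 in auto)
  finally show ?thesis by simp
qed

lemma papp_e_beyond_degree:
  assumes "u < n" "w < n" "degree p < dst u w"
  shows "papp p (std_basis u) w = 0"
  using papp_e_at_distance[of u w p] assms by (simp add: coeff_eq_0)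

lemma papp_e_degree_nonzero:
  assumes "u < n" "v < n" "p \<noteq> 0" "degree p \<le> dst u v"
  obtains w where "w < n" "dst u w = degree p" "papp p (std_basis u) w \<noteq> 0"
proof -
  obtain w where w: "w < n" "dst u w = degree p" using ex_at_distance[OF assms(1,2,4)] .
  then show ?thesis
    using that papp_e_at_distance[of u w p] T_pow_e_gdist_pos[of u w] assms by auto
qed

lemma T_vec: "v \<in> carrier_vec n \<Longrightarrow> i < n \<Longrightarrow> (M *\<^sub>v v) $ i = T (\<lambda>i. v $ i) i"
  by (auto simp: T_def scalar_prod_def atLeast0LessThan)

lemma eigenvector_iff:
  assumes "v \<in> carrier_vec n"
  shows "eigenvector (Defs.adj_mat n E) v t \<longleftrightarrow>
    (\<exists>i<n. v $ i \<noteq> 0) \<and> (\<forall>i<n. T (\<lambda>i. v $ i) i = t * v $ i)"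
  unfolding eigenvector_def adj_mat_M
  using assms T_vec[OF assms] by (auto simp: vec_eq_iff simp del: index_mult_mat_vec)

lemma T_cong: "(\<And>i. i < n \<Longrightarrow> x i = y i) \<Longrightarrow> T x = T y"
  by (auto simp: T_def fun_eq_iff intro!: sum.cong)

lemma eig_iff: "eig t \<longleftrightarrow> t \<in> adj_eigenvalues n E"
proof
  assume "eig t"
  then obtain x where x: "supp x" "x \<noteq> (\<lambda>i. 0)" "T x = (\<lambda>i. t * x i)"
    by (auto simp: eig_def)
  have nz: "\<exists>i<n. x i \<noteq> 0" using x(1,2) by (auto simp: supp_def fun_eq_iff not_le[symmetric])
  have "T (\<lambda>i. vec n x $ i) = T x" by (rule T_cong) simp
  then have "eigenvector (Defs.adj_mat n E) (vec n x) t"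
    unfolding eigenvector_iff[OF vec_carrier]
    using x nz by auto
  then show "t \<in> adj_eigenvalues n E" by (auto simp: adj_eigenvalues_def eigenvalue_def)
next
  assume "t \<in> adj_eigenvalues n E"
  then obtain v where v: "eigenvector (Defs.adj_mat n E) v t"
    by (auto simp: adj_eigenvalues_def eigenvalue_def)
  then have vc: "v \<in> carrier_vec n" by (simp add: eigenvector_def adj_mat_M)
  define x where "x i = (if i < n then v $ i else 0)" for i
  have "T x = T (\<lambda>i. v $ i)" by (rule T_cong) (simp add: x_def)
  then have "T x = (\<lambda>i. t * x i)"
    using v unfolding eigenvector_iff[OF vc] by (auto simp: x_def fun_eq_iff T_def)
  moreover have "supp x" "x \<noteq> (\<lambda>i. 0)"
    using v unfolding eigenvector_iff[OF vc] by (auto simp: x_def supp_def fun_eq_iff)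
  ultimately show "eig t" unfolding eig_def by blast
qed

end

section \<open>Regular graphs: the largest eigenvalue and equitable partitions\<close>

locale reg_graph = conn_graph +
  fixes k :: nat
  assumes reg: "x < n \<Longrightarrow> card {y. y < n \<and> E x y} = k"
begin

definition one :: "nat \<Rightarrow> real" where
  "one i = (if i < n then 1 else 0)"

lemma ex_max_index: "\<exists>i<n. \<forall>j<n. x j \<le> (x i :: real)"
proof -
  have "Max (x ` {..<n}) \<in> x ` {..<n}" using n_pos by (intro Max_in) auto
  then obtain i where "i < n" "Max (x ` {..<n}) = x i" by auto
  moreover have "x j \<le> Max (x ` {..<n})" if "j < n" for j using that by (intro Max_ge) auto
  ultimately show ?thesis by auto
qed

lemma row_sum: "x < n \<Longrightarrow> (\<Sum>y<n. if E x y then 1 else 0) = real k"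
proof -
  assume "x < n"
  have "{..<n} \<inter> {y. E x y} = {y. y < n \<and> E x y}" by auto
  then show ?thesis using reg[OF \<open>x < n\<close>] by (simp add: sum.If_cases)
qed

lemma T_one: "T one = (\<lambda>i. real k * one i)"
  by (auto simp: fun_eq_iff T_def one_def row_sum cong: if_cong)

lemma eig_degree: "eig (real k)"
proof -
  have "supp one" "one \<noteq> (\<lambda>i. 0)" using n_pos by (auto simp: one_def supp_def fun_eq_iff)
  then show ?thesis using T_one unfolding eig_def by blast
qed

text \<open>Compare both sides of the eigenvector equation at an entry of largest absolute
  value.\<close>

lemma eig_le_degree:
  assumes "eig t"
  shows "t \<le> real k"
proof -
  obtain x where x: "supp x" "x \<noteq> (\<lambda>i. 0)" "T x = (\<lambda>i. t * x i)"
    using assms by (auto simp: eig_def)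
  obtain i where i: "i < n" "\<And>j. j < n \<Longrightarrow> \<bar>x j\<bar> \<le> \<bar>x i\<bar>"
    using ex_max_index[of "\<lambda>i. \<bar>x i\<bar>"] by auto
  have "x i \<noteq> 0"
  proof
    assume "x i = 0"
    then have "x j = 0" for j using i(2)[of j] x(1) by (cases "j < n") (auto simp: supp_def)
    then show False using x(2) by auto
  qed
  have "\<bar>t\<bar> * \<bar>x i\<bar> = \<bar>T x i\<bar>" using x by (simp add: abs_mult)
  also have "\<dots> \<le> (\<Sum>j<n. \<bar>(if E i j then 1 else 0) * x j\<bar>)"
    using i by (simp add: T_def)
  also have "\<dots> \<le> (\<Sum>j<n. (if E i j then 1 else 0) * \<bar>x i\<bar>)"
    by (rule sum_mono) (use i in auto)
  also have "\<dots> = real k * \<bar>x i\<bar>"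
    using row_sum[OF i(1)] by (simp add: sum_distrib_right[symmetric])
  finally show ?thesis using \<open>x i \<noteq> 0\<close> by simp
qed

text \<open>Maximum principle: at a vertex with maximal entry, the differences to the neighbours are
  nonnegative and sum to 0. The maximum thus spreads along walks to all vertices.\<close>

lemma degree_eigenvector_constant:
  assumes "\<And>i. i < n \<Longrightarrow> T x i = real k * x i" "w < n" "w' < n"
  shows "x w = x w'"
proof -
  obtain i where i: "i < n" "\<And>j. j < n \<Longrightarrow> x j \<le> x i"
    using ex_max_index[of x] by auto
  have nb: "x j = x i" if "y < n" "x y = x i" "j < n" "E y j" for y j
  proof -
    let ?f = "\<lambda>j. (if E y j then 1 else 0) * (x i - x j)"
    have nn: "\<And>j. j \<in> {..<n} \<Longrightarrow> 0 \<le> ?f j" using i by auto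
    have "sum ?f {..<n} = real k * x i - T x y"
      using that(1) row_sum[OF that(1)]
      by (simp add: T_def algebra_simps sum_subtractf sum_distrib_left[symmetric])
    then have "sum ?f {..<n} = 0" using assms(1)[OF that(1)] that(2) by simp
    then have "?f j = 0" using sum_nonneg_eq_0_iff[OF finite_lessThan nn] that(3) by auto
    then show ?thesis using that(4) by simp
  qed
  have "x w = x i" if "(i, w) \<in> R ^^ m" for m w
    using that
  proof (induction m arbitrary: w)
    case (Suc m)
    then obtain y where "(i, y) \<in> R ^^ m" "y < n" "w < n" "E y w"
      by (auto simp: edge_rel_def)
    then show ?case using Suc.IH nb by blast
  qed simp
  then show ?thesis using gdist_walk i(1) assms(2,3) by metis
qed

lemma dot_one_papp_e: "w < n \<Longrightarrow> dot one (papp p (std_basis w)) = poly p (real k)"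
proof -
  assume w: "w < n"
  have "papp p one = (\<lambda>i. poly p (real k) * one i)"
    using papp_eigen[OF T_one] by (rule ext)
  then have "dot (papp p one) (std_basis w) = poly p (real k) * dot one (std_basis w)" by (simp add: dot_scale)
  moreover have "dot one (std_basis w) = 1" using dot_e[OF w, of one] w by (simp add: dot_commute one_def)
  ultimately show ?thesis by (simp add: dot_papp)
qed

lemma Max_adj_eigenvalues:
  assumes "finite (adj_eigenvalues n E)"
  shows "Max (adj_eigenvalues n E) = real k"
  by (rule Max_eqI) (use assms eig_le_degree eig_degree eig_iff in auto)

lemma perron_vector_iff:
  assumes "finite (adj_eigenvalues n E)"
  shows "perron_vector n E \<phi> \<longleftrightarrow>
    \<phi> \<in> carrier_vec n \<and> (\<exists>c>0. \<forall>i<n. \<phi> $ i = c)"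
proof
  assume p: "perron_vector n E \<phi>"
  then have ev: "eigenvector (Defs.adj_mat n E) \<phi> (real k)" and pos: "\<And>i. i < n \<Longrightarrow> 0 < \<phi> $ i"
    by (auto simp: perron_vector_def Max_adj_eigenvalues[OF assms])
  then have c: "\<phi> \<in> carrier_vec n" by (simp add: eigenvector_def adj_mat_M)
  have "\<phi> $ i = \<phi> $ 0" if "i < n" for i
    using degree_eigenvector_constant[of "\<lambda>i. \<phi> $ i" i 0] ev that n_pos
    unfolding eigenvector_iff[OF c] by auto
  then show "\<phi> \<in> carrier_vec n \<and> (\<exists>c>0. \<forall>i<n. \<phi> $ i = c)" using c pos n_pos by blast
next
  assume r: "\<phi> \<in> carrier_vec n \<and> (\<exists>c>0. \<forall>i<n. \<phi> $ i = c)"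
  then obtain c where c: "c > 0" "\<And>i. i < n \<Longrightarrow> \<phi> $ i = c" by auto
  have "T (\<lambda>i. \<phi> $ i) = T (\<lambda>i. c * one i)" by (rule T_cong) (simp add: c one_def)
  then have "T (\<lambda>i. \<phi> $ i) i = real k * \<phi> $ i" if "i < n" for i
    using that c by (simp only: T_scale T_one) (simp add: one_def)
  then have "eigenvector (Defs.adj_mat n E) \<phi> (real k)"
    using r c n_pos eigenvector_iff[of \<phi>] by auto
  then show "perron_vector n E \<phi>"
    using c by (simp add: perron_vector_def Max_adj_eigenvalues[OF assms])
qed

text \<open>A Perron vector of a regular graph is a positive constant, which cancels in the
  quotient. What remains is A applied to the indicator of a class.\<close>

lemma pseudo_equitable_iff:
  assumes "finite (adj_eigenvalues n E)"
  shows "pseudo_equitable n E P \<longleftrightarrow> is_partition n P \<and>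
    (\<forall>C\<in>P. \<forall>C'\<in>P. \<forall>x\<in>C'. \<forall>x'\<in>C'. T (\<lambda>i. if i \<in> C then 1 else 0) x = T (\<lambda>i. if i \<in> C then 1 else 0) x')"
proof -
  have *: "(\<Sum>y\<in>C. Defs.adj_mat n E $$ (x, y) * \<phi> $ y / \<phi> $ x) = T (\<lambda>i. if i \<in> C then 1 else 0) x"
    if part: "is_partition n P" and C: "C \<in> P" "C' \<in> P" "x \<in> C'"
      and perron: "perron_vector n E \<phi>" for C C' x \<phi>
  proof -
    have s: "\<Union> P = {0..<n}" using part by (simp add: is_partition_def)
    then have CC: "C \<subseteq> {..<n}" "C' \<subseteq> {..<n}" using C by auto
    obtain c where c: "c > 0" "\<And>i. i < n \<Longrightarrow> \<phi> $ i = c"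
      using perron perron_vector_iff[OF assms] by auto
    have x: "x < n" using CC C by auto
    have "(\<Sum>y\<in>C. Defs.adj_mat n E $$ (x, y) * \<phi> $ y / \<phi> $ x) = (\<Sum>y\<in>C. if E x y then 1 else 0)"
      by (rule sum.cong) (use CC x c in \<open>auto simp: Defs.adj_mat_def\<close>)
    also have "\<dots> = (\<Sum>y<n. (if E x y then 1 else 0) * (if y \<in> C then 1 else 0))"
      by (rule sum.mono_neutral_cong_left) (use CC in auto)
    finally show ?thesis using x by (simp add: T_def)
  qed
  have perron: "perron_vector n E (vec n (\<lambda>_. 1))" unfolding perron_vector_iff[OF assms] by (auto intro!: exI[of _ 1])
  show ?thesis (is "?L \<longleftrightarrow> ?R")
  proof
    assume ?L
    then obtain \<phi> where part: "is_partition n P" and \<phi>: "perron_vector n E \<phi>"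
      and eq: "\<And>C C' x x'. C \<in> P \<Longrightarrow> C' \<in> P \<Longrightarrow> x \<in> C' \<Longrightarrow> x' \<in> C' \<Longrightarrow>
        (\<Sum>y\<in>C. Defs.adj_mat n E $$ (x, y) * \<phi> $ y / \<phi> $ x)
        = (\<Sum>y\<in>C. Defs.adj_mat n E $$ (x', y) * \<phi> $ y / \<phi> $ x')"
      unfolding pseudo_equitable_def by blast
    show ?R
    proof (intro conjI ballI part)
      fix C C' x x' assume C: "C \<in> P" "C' \<in> P" "x \<in> C'" "x' \<in> C'"
      show "T (\<lambda>i. if i \<in> C then 1 else 0) x = T (\<lambda>i. if i \<in> C then 1 else 0) x'"
        using eq[OF C] unfolding *[OF part C(1,2,3) \<phi>] *[OF part C(1,2,4) \<phi>] .
    qed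
  next
    assume r: ?R
    then have part: "is_partition n P" by blast
    show ?L unfolding pseudo_equitable_def
    proof (intro conjI exI[of _ "vec n (\<lambda>_. 1)"] ballI part perron)
      fix C C' x x' assume C: "C \<in> P" "C' \<in> P" "x \<in> C'" "x' \<in> C'"
      show "(\<Sum>y\<in>C. Defs.adj_mat n E $$ (x, y) * vec n (\<lambda>_. 1) $ y / vec n (\<lambda>_. 1) $ x)
        = (\<Sum>y\<in>C. Defs.adj_mat n E $$ (x', y) * vec n (\<lambda>_. 1) $ y / vec n (\<lambda>_. 1) $ x')"
        unfolding *[OF part C(1,2,3) perron] *[OF part C(1,2,4) perron] using r C by blast
    qed
  qed
qed

end

section \<open>Products of linear factors and a coefficient count\<close>

lemma degree_prod_linear:
  fixes f :: "'a \<Rightarrow> 'b :: idom"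
  assumes "finite S"
  shows "degree (\<Prod>s\<in>S. [:- f s, 1:]) = card S"
    and "coeff (\<Prod>s\<in>S. [:- f s, 1:]) (card S) = 1"
proof -
  have "degree (\<Prod>s\<in>S. [:- f s, 1:]) = card S \<and> lead_coeff (\<Prod>s\<in>S. [:- f s, 1:]) = 1"
    using assms
  proof (induction S)
    case (insert s S)
    let ?q = "\<Prod>s\<in>S. [:- f s, 1:]"
    have "?q \<noteq> 0" using insert by auto
    then have "degree ([:- f s, 1:] * ?q) = Suc (card S)"
      using insert degree_mult_eq[of "[:- f s, 1:]" ?q] by simp
    moreover have "lead_coeff ([:- f s, 1:] * ?q) = 1"
      by (simp only: lead_coeff_mult insert.IH[THEN conjunct2]) simp
    ultimately show ?case using insert by simp
  qed simp
  then show "degree (\<Prod>s\<in>S. [:- f s, 1:]) = card S"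
    and "coeff (\<Prod>s\<in>S. [:- f s, 1:]) (card S) = 1" by auto
qed

lemma sum_lessThan_add:
  fixes f :: "nat \<Rightarrow> 'a :: comm_monoid_add"
  shows "sum f {..<m + k} = sum f {..<m} + (\<Sum>j<k. f (m + j))"
  by (induction k) (auto simp: add.assoc)

text \<open>The polynomials have \<open>i + 1\<close> and \<open>d - i + 1\<close> coefficients, in
  total \<open>d + 2\<close> unknowns for \<open>d + 1\<close> homogeneous linear equations. In the
  matrix, the columns below \<open>i + 1\<close> belong to \<open>f\<close> and the others to
  \<open>g\<close>.\<close>

lemma ex_poly_pair:
  fixes \<theta> \<sigma> :: "nat \<Rightarrow> 'a :: field"
  assumes "i \<le> d"
  obtains f g :: "'a poly" where "f \<noteq> 0 \<or> g \<noteq> 0" "degree f \<le> i" "degree g \<le> d - i"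
    "\<And>r. r \<le> d \<Longrightarrow> poly f (\<theta> r) = \<sigma> r * poly g (\<theta> r)"
proof -
  define h where "h r j = (if r = d + 1 then 0 else if j < i + 1 then \<theta> r ^ j
    else - \<sigma> r * \<theta> r ^ (j - (i + 1)))" for r j
  define A where "A = mat (d + 2) (d + 2) (\<lambda>(r, j). h r j)"
  have A: "A \<in> carrier_mat (d + 2) (d + 2)" by (simp add: A_def)
  \<comment> \<open>The last row is zero, expressing that there is one unknown more than equations.\<close>
  have "det A = (\<Sum>j<d + 2. A $$ (d + 1, j) * cofactor A (d + 1) j)"
    by (rule laplace_expansion_row[OF A]) simp
  also have "\<dots> = 0" by (rule sum.neutral) (simp add: A_def h_def)
  finally obtain v where v: "v \<in> carrier_vec (d + 2)" "v \<noteq> 0\<^sub>v (d + 2)"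
    "A *\<^sub>v v = 0\<^sub>v (d + 2)"
    using det_0_iff_vec_prod_zero_field[OF A] by auto
  define f where "f = (\<Sum>j<i + 1. monom (v $ j) j)"
  define g where "g = (\<Sum>j<d - i + 1. monom (v $ (i + 1 + j)) j)"
  have cf: "coeff f j = (if j < i + 1 then v $ j else 0)" for j
    unfolding f_def by (simp add: coeff_sum coeff_monom sum.delta cong: if_cong)
  have cg: "coeff g j = (if j < d - i + 1 then v $ (i + 1 + j) else 0)" for j
    unfolding g_def by (simp add: coeff_sum coeff_monom sum.delta cong: if_cong)
  have "f \<noteq> 0 \<or> g \<noteq> 0"
  proof -
    obtain j where j: "j < d + 2" "v $ j \<noteq> 0" using v(1,2) by (auto simp: vec_eq_iff)
    show ?thesis
    proof (cases "j < i + 1")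
      case True
      then have "coeff f j \<noteq> 0" using j by (simp add: cf)
      then show ?thesis by auto
    next
      case False
      then have "coeff g (j - (i + 1)) \<noteq> 0" using j assms by (simp add: cg)
      then show ?thesis by auto
    qed
  qed
  moreover have "degree f \<le> i" "degree g \<le> d - i"
    by (rule degree_le; simp add: cf cg)+
  moreover have "poly f (\<theta> r) = \<sigma> r * poly g (\<theta> r)" if "r \<le> d" for r
  proof -
    have "0 = (A *\<^sub>v v) $ r" using v(3) that by simp
    also have "\<dots> = (\<Sum>j<(i + 1) + (d - i + 1). h r j * v $ j)"
      using that assms v(1) by (simp add: A_def scalar_prod_def atLeast0LessThan)
    also have "\<dots> = (\<Sum>j<i + 1. h r j * v $ j) + (\<Sum>j<d - i + 1. h r (i + 1 + j) * v $ (i + 1 + j))"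
      by (rule sum_lessThan_add)
    also have "(\<Sum>j<i + 1. h r j * v $ j) = poly f (\<theta> r)"
      unfolding f_def poly_sum poly_monom
      by (rule sum.cong) (use that in \<open>auto simp: h_def\<close>)
    also have "(\<Sum>j<d - i + 1. h r (i + 1 + j) * v $ (i + 1 + j)) = - \<sigma> r * poly g (\<theta> r)"
      unfolding g_def poly_sum poly_monom sum_distrib_left
      by (rule sum.cong) (use that in \<open>auto simp: h_def\<close>)
    finally show ?thesis by simp
  qed
  ultimately show ?thesis using that by blast
qed

section \<open>Lagrange interpolation on the spectrum\<close>

locale extremal_graph = reg_graph +
  fixes \<theta> :: "nat \<Rightarrow> real"
  assumes \<theta>_less: "r < s \<Longrightarrow> s \<le> d \<Longrightarrow> \<theta> s < \<theta> r"
    and eigenvalues: "adj_eigenvalues n E = \<theta> ` {0..d}"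
begin

lemma \<theta>_eq_iff: "r \<le> d \<Longrightarrow> s \<le> d \<Longrightarrow> \<theta> r = \<theta> s \<longleftrightarrow> r = s"
  using \<theta>_less[of r s] \<theta>_less[of s r] by (cases r s rule: linorder_cases) auto

lemma degree_eq_\<theta>_0: "real k = \<theta> 0"
proof -
  have "Max (\<theta> ` {0..d}) = \<theta> 0"
    using \<theta>_less[of 0] by (intro Max_eqI) (auto simp: le_less)
  then show ?thesis using Max_adj_eigenvalues eigenvalues by simp
qed

lemma poly_eq_0_if_vanishes:
  assumes "degree p \<le> d" "\<And>r. r \<le> d \<Longrightarrow> poly p (\<theta> r) = 0"
  shows "p = 0"
proof (rule ccontr)
  assume p: "p \<noteq> 0"
  have "inj_on \<theta> {0..d}" by (rule inj_onI) (simp add: \<theta>_eq_iff)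
  then have "d + 1 = card (\<theta> ` {0..d})" by (simp add: card_image)
  also have "\<dots> \<le> card {x. poly p x = 0}"
    by (rule card_mono) (use assms p poly_roots_finite in auto)
  also have "\<dots> \<le> degree p" by (rule card_poly_roots_bound[OF p])
  finally show False using assms by simp
qed

text \<open>The product of the linear factors of all eigenvalues annihilates
  \<open>std_basis w\<close>: \<open>annihilator_reduce\<close> obtains it from the characteristic
  polynomial. It also divides \<open>p - q\<close>, because the remainder has degree at most
  \<open>d\<close> and \<open>d + 1\<close> roots. This takes the place of the spectral
  decomposition.\<close>

lemma papp_e_cong:
  assumes "\<And>r. r \<le> d \<Longrightarrow> poly p (\<theta> r) = poly q (\<theta> r)" "w < n"
  shows "papp p (std_basis w) = papp q (std_basis w)"
proof -
  let ?m = "\<Prod>t\<in>\<theta> ` {0..d}. [:- t, 1:]"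
  have inj: "inj_on \<theta> {0..d}" by (rule inj_onI) (simp add: \<theta>_eq_iff)
  have m: "degree ?m = d + 1"
    using degree_prod_linear(1)[of "\<theta> ` {0..d}" "\<lambda>t. t"] inj by (simp add: card_image)
  have m0: "poly ?m (\<theta> r) = 0" if "r \<le> d" for r
    using that by (auto simp: poly_prod prod_zero_iff)
  have "(p - q) mod ?m = 0"
  proof (rule poly_eq_0_if_vanishes)
    have "?m \<noteq> 0" using m by auto
    then show "degree ((p - q) mod ?m) \<le> d" using degree_mod_less[of ?m "p - q"] m by auto
    fix r assume r: "r \<le> d"
    have "poly (p - q) (\<theta> r) = poly ((p - q) div ?m * ?m + (p - q) mod ?m) (\<theta> r)"
      by (simp only: div_mult_mod_eq)
    then show "poly ((p - q) mod ?m) (\<theta> r) = 0"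
      using assms(1)[OF r] unfolding poly_add poly_mult m0[OF r] by simp
  qed
  then have pq: "p - q = (p - q) div ?m * ?m"
    using div_mult_mod_eq[of "p - q" ?m] by simp
  have "char_poly M \<noteq> 0" using degree_char_poly_M by auto
  then have "papp ?m (std_basis w) = (\<lambda>i. 0)"
    using annihilator_reduce[of "\<theta> ` {0..d}" "char_poly M" "std_basis w"] cayley_hamilton[OF assms(2)]
      supp_e[OF assms(2)] eig_iff eigenvalues by auto
  then have "papp ((p - q) div ?m * ?m) (std_basis w) = (\<lambda>i. 0)" by (simp add: papp_mult fun_eq_iff[of "papp _ (\<lambda>i. 0)"])
  then have "papp (p - q) (std_basis w) = (\<lambda>i. 0)" using pq by simp
  then show ?thesis by (simp add: fun_eq_iff papp_diff)
qed

text \<open>This is the leading coefficient of the Lagrange polynomial below, and also the product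
  occurring in the equation to be characterised.\<close>

definition lag_coeff :: "nat \<Rightarrow> real" where
  "lag_coeff r = (\<Prod>s\<in>{0..d} - {r}. 1 / (\<theta> r - \<theta> s))"

text \<open>Evaluated at A, this is the orthogonal projection E_r onto the eigenspace of
  \<open>\<theta> r\<close>.\<close>

definition lagrange :: "nat \<Rightarrow> real poly" where
  "lagrange r = Polynomial.smult (lag_coeff r) (\<Prod>s\<in>{0..d} - {r}. [:- \<theta> s, 1:])"

text \<open>The polynomial Q of the overview, of degree at most \<open>d\<close>.\<close>

definition alt_poly :: "real poly" where
  "alt_poly = (\<Sum>r\<in>{0..d}. Polynomial.smult ((-1) ^ r) (lagrange r))"

text \<open>Exactly the \<open>r\<close> factors with \<open>s < r\<close> are negative.\<close>

lemma lag_coeff_sign: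
  assumes "r \<le> d"
  shows "0 < (-1) ^ r * lag_coeff r"
proof -
  have "{0..d} - {r} = {0..<r} \<union> {r<..d}" using assms by auto
  then have "lag_coeff r = (\<Prod>s\<in>{0..<r} \<union> {r<..d}. 1 / (\<theta> r - \<theta> s))" by (simp only: lag_coeff_def)
  also have "\<dots> = (\<Prod>s\<in>{0..<r}. 1 / (\<theta> r - \<theta> s)) * (\<Prod>s\<in>{r<..d}. 1 / (\<theta> r - \<theta> s))"
    by (rule prod.union_disjoint) auto
  also have "(\<Prod>s\<in>{0..<r}. 1 / (\<theta> r - \<theta> s)) = (\<Prod>s\<in>{0..<r}. (-1) * (1 / (\<theta> s - \<theta> r)))"
    by (rule prod.cong) (auto simp: divide_simps)
  also have "\<dots> = (-1) ^ r * (\<Prod>s\<in>{0..<r}. 1 / (\<theta> s - \<theta> r))"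
    unfolding prod.distrib by simp
  finally have cr: "lag_coeff r = (-1) ^ r * (\<Prod>s\<in>{0..<r}. 1 / (\<theta> s - \<theta> r)) * (\<Prod>s\<in>{r<..d}. 1 / (\<theta> r - \<theta> s))" .
  have "(-1) ^ r * (-1) ^ r = (1 :: real)" by (simp flip: power_add)
  then have "(-1) ^ r * lag_coeff r = (\<Prod>s\<in>{0..<r}. 1 / (\<theta> s - \<theta> r)) * (\<Prod>s\<in>{r<..d}. 1 / (\<theta> r - \<theta> s))"
    by (simp only: cr mult.assoc[symmetric] mult_1)
  moreover have "0 < (\<Prod>s\<in>{0..<r}. 1 / (\<theta> s - \<theta> r))"
    by (rule prod_pos) (use \<theta>_less assms in auto)
  moreover have "0 < (\<Prod>s\<in>{r<..d}. 1 / (\<theta> r - \<theta> s))"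
    by (rule prod_pos) (use \<theta>_less assms in auto)
  ultimately show ?thesis by simp
qed

lemma lag_coeff_nonzero: "r \<le> d \<Longrightarrow> lag_coeff r \<noteq> 0"
  using lag_coeff_sign[of r] by auto

lemma degree_lag: "r \<le> d \<Longrightarrow> degree (lagrange r) = d"
  and coeff_lagrange: "r \<le> d \<Longrightarrow> coeff (lagrange r) d = lag_coeff r"
  using degree_prod_linear[of "{0..d} - {r}" \<theta>] lag_coeff_nonzero by (auto simp: lagrange_def)

lemma poly_lag: "r \<le> d \<Longrightarrow> s \<le> d \<Longrightarrow> poly (lagrange r) (\<theta> s) = (if r = s then 1 else 0)"
proof -
  assume rs: "r \<le> d" "s \<le> d"
  show ?thesis
  proof (cases "r = s")
    case True
    have "lag_coeff r * (\<Prod>s\<in>{0..d} - {r}. \<theta> r - \<theta> s) = (\<Prod>s\<in>{0..d} - {r}. 1)"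
      unfolding lag_coeff_def prod.distrib[symmetric]
      by (rule prod.cong) (use rs \<theta>_eq_iff in auto)
    then show ?thesis using True by (simp add: lagrange_def poly_prod)
  next
    case False
    then have "s \<in> {0..d} - {r}" using rs by auto
    then have "(\<Prod>t\<in>{0..d} - {r}. \<theta> s - \<theta> t) = 0" by (intro prod_zero) auto
    then show ?thesis using False by (simp add: lagrange_def poly_prod)
  qed
qed

lemma sum_lag:
  fixes z :: "nat \<Rightarrow> real"
  defines "q \<equiv> \<Sum>r\<in>{0..d}. Polynomial.smult (z r) (lagrange r)"
  shows "degree q \<le> d" "coeff q d = (\<Sum>r\<in>{0..d}. z r * lag_coeff r)"
    and "r \<le> d \<Longrightarrow> poly q (\<theta> r) = z r"
proof -
  show "degree q \<le> d" unfolding q_def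
    by (rule degree_sum_le) (use degree_lag in \<open>auto intro: order_trans[OF degree_smult_le]\<close>)
  show "coeff q d = (\<Sum>r\<in>{0..d}. z r * lag_coeff r)"
    unfolding q_def coeff_sum by (rule sum.cong) (auto simp: coeff_lagrange)
  assume r: "r \<le> d"
  have "poly q (\<theta> r) = (\<Sum>s\<in>{0..d}. z s * (if s = r then 1 else 0))"
    unfolding q_def poly_sum by (rule sum.cong) (use r poly_lag in auto)
  then show "poly q (\<theta> r) = z r" using r by (simp add: sum.delta if_distrib cong: if_cong)
qed

lemmas alt_poly_props = sum_lag[where z = "\<lambda>r. (-1) ^ r", folded alt_poly_def]

text \<open>Multiplying by the linear factor of \<open>\<theta> 0\<close> gives a polynomial
  vanishing on the spectrum, so the vector is fixed up to the factor \<open>k\<close> by A and hence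
  constant. Its entries sum to the value of \<open>lagrange 0\<close> at \<open>\<theta> 0\<close>,
  which is 1.\<close>

lemma papp_lag_0:
  assumes "u < n" "w < n"
  shows "papp (lagrange 0) (std_basis u) w = 1 / real n"
proof -
  let ?x = "papp (lagrange 0) (std_basis u)"
  have "papp ([:- \<theta> 0, 1:] * lagrange 0) (std_basis u) = papp 0 (std_basis u)"
    by (rule papp_e_cong) (use assms poly_lag[of 0] in auto)
  then have "T ?x i = real k * ?x i" for i
    by (simp only: papp_mult fun_eq_iff papp_linear papp_0) (simp add: degree_eq_\<theta>_0)
  then have const: "?x i = ?x w" if "i < n" for i
    using degree_eigenvector_constant that assms by blast
  have "1 = dot one ?x"
    using dot_one_papp_e[OF assms(1)] poly_lag[of 0 0] by (simp add: degree_eq_\<theta>_0)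
  also have "\<dots> = (\<Sum>i<n. ?x w)" unfolding dot_def
    by (rule sum.cong) (use const in \<open>auto simp: one_def\<close>)
  finally show ?thesis using n_pos by (simp add: field_simps)
qed

end

section \<open>Two vertices at distance \<open>d\<close>: the equation as a swap of basis
  vectors\<close>

locale extremal_pair = extremal_graph +
  fixes u v :: nat
  assumes u: "u < n" and v: "v < n" and uv: "dst u v = d"
begin

lemma papp_uv: "degree p \<le> d \<Longrightarrow> papp p (std_basis u) v = coeff p d * (T ^^ d) (std_basis u) v"
  using papp_e_at_distance[OF u v] uv by simp

lemma T_pow_uv_pos: "0 < (T ^^ d) (std_basis u) v"
  using T_pow_e_gdist_pos[OF u v] uv by simp

text \<open>Multiply both sides by the positive number \<open>?W\<close> of walks of length
  \<open>d\<close> from \<open>u\<close> to \<open>v\<close>. The left becomes 1 by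
  \<open>papp_lag_0\<close>, and the right becomes the entry of Q(A).\<close>

lemma equation_iff_entry:
  "real n * (\<Prod>s\<in>{1..d}. 1 / (\<theta> 0 - \<theta> s))
    = (\<Sum>r\<in>{0..d}. (-1) ^ r * (\<Prod>s\<in>{0..d} - {r}. 1 / (\<theta> r - \<theta> s)))
   \<longleftrightarrow> papp alt_poly (std_basis u) v = 1"
proof -
  let ?W = "(T ^^ d) (std_basis u) v"
  have "{0..d} - {0} = {1..d}" by auto
  then have lhs: "(\<Prod>s\<in>{1..d}. 1 / (\<theta> 0 - \<theta> s)) = lag_coeff 0" by (simp add: lag_coeff_def)
  have rhs: "(\<Sum>r\<in>{0..d}. (-1) ^ r * (\<Prod>s\<in>{0..d} - {r}. 1 / (\<theta> r - \<theta> s))) = coeff alt_poly d"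
    using alt_poly_props(2) by (simp add: lag_coeff_def)
  have "lag_coeff 0 * ?W = 1 / real n"
    using papp_uv[of "lagrange 0"] papp_lag_0[OF u v] by (simp add: degree_lag coeff_lagrange)
  then have "real n * lag_coeff 0 * ?W = 1" using n_pos by (simp add: field_simps)
  moreover have "papp alt_poly (std_basis u) v = coeff alt_poly d * ?W" using papp_uv alt_poly_props(1) by simp
  ultimately have "real n * lag_coeff 0 = coeff alt_poly d \<longleftrightarrow> papp alt_poly (std_basis u) v = 1"
    using T_pow_uv_pos mult_right_cancel[of ?W "real n * lag_coeff 0" "coeff alt_poly d"] by auto
  then show ?thesis using lhs rhs by simp
qed

lemma alt_poly_square: "w < n \<Longrightarrow> papp alt_poly (papp alt_poly (std_basis w)) = std_basis w"
proof -
  assume w: "w < n"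
  have "papp (alt_poly * alt_poly) (std_basis w) = papp 1 (std_basis w)"
    by (rule papp_e_cong) (use w alt_poly_props(3) in \<open>auto simp: minus_one_power_iff\<close>)
  then show ?thesis by (simp add: papp_mult fun_eq_iff)
qed

text \<open>Since Q(A) is symmetric with square the identity, Q(A)e_u is a unit vector. Two unit
  vectors with inner product 1 coincide.\<close>

lemma entry_iff_swap: "papp alt_poly (std_basis u) v = 1 \<longleftrightarrow> papp alt_poly (std_basis u) = std_basis v"
proof
  assume *: "papp alt_poly (std_basis u) v = 1"
  let ?y = "papp alt_poly (std_basis u)" and ?z = "\<lambda>i. papp alt_poly (std_basis u) i + (-1) * std_basis v i"
  have s: "supp ?z" using supp_papp[OF supp_e[OF u], of alt_poly] supp_e[OF v] by (simp add: supp_def)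
  have "dot ?y ?y = 1"
  proof -
    have "dot ?y ?y = dot (std_basis u) (papp alt_poly ?y)" by (rule dot_papp)
    also have "\<dots> = std_basis u u" unfolding alt_poly_square[OF u] by (rule dot_e[OF u])
    finally show ?thesis by (simp add: std_basis_def)
  qed
  moreover have "dot ?y (std_basis v) = 1" using * dot_e[OF v, of ?y] dot_commute[of ?y "std_basis v"] by linarith
  moreover have "dot (std_basis v) (std_basis v) = 1" using dot_e[OF v, of "std_basis v"] by (simp only: std_basis_def) simp
  moreover have "dot ?z ?z = dot ?y ?y - 2 * dot ?y (std_basis v) + dot (std_basis v) (std_basis v)"
  proof -
    have *: "dot ?z w = dot ?y w - dot (std_basis v) w" for w
      using dot_add[of ?y "\<lambda>i. (-1) * std_basis v i" w] dot_scale[of "-1" "std_basis v" w] by linarith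
    show ?thesis using *[of ?z] *[of ?y] *[of "std_basis v"] dot_commute[of ?z ?y]
        dot_commute[of ?z "std_basis v"] dot_commute[of "std_basis v" ?y] by linarith
  qed
  ultimately have "dot ?z ?z = 0" by linarith
  then have "?z = (\<lambda>i. 0)" using dot_self_eq_0[OF s] by (rule iffD1[rotated])
  then have "?y i - std_basis v i = 0" for i by (auto dest: fun_cong[of _ _ i])
  then show "?y = std_basis v" by (simp only: right_minus_eq) (rule ext)
qed (simp add: std_basis_def)

end

section \<open>From the swap to antipodality\<close>

context extremal_pair
begin

text \<open>Take \<open>f\<close> and \<open>g\<close> with f = g Q on the spectrum, so that f(A)e_u
  = g(A)e_v. The degree bounds confine the support to distance at most \<open>i\<close> from
  \<open>u\<close> and \<open>d - i\<close> from \<open>v\<close>, and the triangle inequality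
  forces equality.\<close>

lemma ex_shell_poly:
  assumes swap: "papp alt_poly (std_basis u) = std_basis v" and i: "i \<le> d"
  obtains f where "degree f = i" "f \<noteq> 0"
    "\<And>w. w < n \<Longrightarrow> papp f (std_basis u) w \<noteq> 0 \<Longrightarrow> dst u w = i \<and> dst v w = d - i"
proof -
  obtain f g :: "real poly" where fg: "f \<noteq> 0 \<or> g \<noteq> 0" "degree f \<le> i" "degree g \<le> d - i"
    "\<And>r. r \<le> d \<Longrightarrow> poly f (\<theta> r) = (-1) ^ r * poly g (\<theta> r)"
    using ex_poly_pair[OF i, where \<theta> = \<theta> and \<sigma> = "\<lambda>r. (-1) ^ r"] by blast
  have f0: "f \<noteq> 0"
  proof
    assume "f = 0"
    then have "g = 0"
      by (intro poly_eq_0_if_vanishes) (use fg i in auto)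
    then show False using fg \<open>f = 0\<close> by simp
  qed
  have "papp f (std_basis u) = papp (g * alt_poly) (std_basis u)"
    by (rule papp_e_cong) (use fg(4) alt_poly_props(3) u in auto)
  also have "\<dots> = papp g (std_basis v)" by (simp add: papp_mult swap)
  finally have fg_eq: "papp f (std_basis u) = papp g (std_basis v)" .
  have *: "dst u w = i \<and> dst v w = d - i" if w: "w < n" and nz: "papp f (std_basis u) w \<noteq> 0" for w
  proof -
    have "dst u w \<le> i"
      using papp_e_beyond_degree[OF u w, of f] nz fg(2) by force
    moreover have "dst v w \<le> d - i"
      using papp_e_beyond_degree[OF v w, of g] nz fg(3) fg_eq by force
    moreover have "d \<le> dst u w + dst v w"
      using gdist_triangle[OF u v w] gdist_sym[OF v w] uv by simp
    ultimately show ?thesis using i by arith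
  qed
  \<comment> \<open>The vector is nonzero at some vertex at distance \<open>degree f\<close> from
    \<open>u\<close>, and by the support condition this distance is \<open>i\<close>.\<close>
  obtain w where "w < n" "dst u w = degree f" "papp f (std_basis u) w \<noteq> 0"
    using papp_e_degree_nonzero[OF u v f0] fg(2) i uv by auto
  then have "degree f = i" using * by auto
  then show ?thesis using that f0 * by blast
qed

text \<open>One polynomial of each degree forms a basis; coefficients are removed from the top. The
  bound is put as vanishing coefficients from \<open>m\<close> on, so that \<open>m = 0\<close>
  covers the zero polynomial.\<close>

lemma shell_expansion:
  fixes F :: "nat \<Rightarrow> real poly"
  assumes F: "\<And>i. i \<le> d \<Longrightarrow> degree (F i) = i \<and> F i \<noteq> 0"
  shows "m \<le> d + 1 \<Longrightarrow> (\<And>j. m \<le> j \<Longrightarrow> coeff p j = 0)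
    \<Longrightarrow> \<exists>b. p = (\<Sum>i<m. Polynomial.smult (b i) (F i))"
proof (induction m arbitrary: p)
  case 0
  then have "p = 0" by (intro poly_eqI) simp
  then show ?case by simp
next
  case (Suc m)
  define t where "t = coeff p m / coeff (F m) m"
  let ?q = "p - Polynomial.smult t (F m)"
  have Fm: "degree (F m) = m" "F m \<noteq> 0" using F[of m] Suc.prems(1) by auto
  then have Fc: "coeff (F m) m \<noteq> 0" by (metis leading_coeff_0_iff)
  have "coeff ?q j = 0" if "m \<le> j" for j
  proof (cases "j = m")
    case True
    then show ?thesis using Fc by (simp add: t_def)
  next
    case False
    then show ?thesis using that Suc.prems(2)[of j] Fm by (simp add: coeff_eq_0)
  qed
  then obtain b where b: "?q = (\<Sum>i<m. Polynomial.smult (b i) (F i))"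
    using Suc.IH[of ?q] Suc.prems(1) by auto
  have "p = (\<Sum>i<Suc m. Polynomial.smult ((b(m := t)) i) (F i))"
  proof -
    have "(\<Sum>i<m. Polynomial.smult ((b(m := t)) i) (F i)) = ?q"
      unfolding b by (rule sum.cong) auto
    then show ?thesis by simp
  qed
  then show ?case by blast
qed

text \<open>The shell vectors \<open>X i\<close> have disjoint supports and span all p(A)e_u.
  Expanding the all-one vector in them shows that each is a nonzero multiple of the indicator of a
  distance class, and A maps these indicators back into their span.\<close>

lemma swap_imp_distance_indicators:
  assumes swap: "papp alt_poly (std_basis u) = std_basis v"
  shows "w < n \<Longrightarrow> dst v w = d - dst u w"
    and "x < n \<Longrightarrow> x' < n \<Longrightarrow> dst u x = dst u x'
      \<Longrightarrow> T (\<lambda>w. if dst u w = i then 1 else 0) x = T (\<lambda>w. if dst u w = i then 1 else 0) x'"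
proof -
  have "\<forall>i. \<exists>f. i \<le> d \<longrightarrow> degree f = i \<and> f \<noteq> 0 \<and>
    (\<forall>w<n. papp f (std_basis u) w \<noteq> 0 \<longrightarrow> dst u w = i \<and> dst v w = d - i)"
    using ex_shell_poly[OF swap] by metis
  then obtain F where F: "\<And>i. i \<le> d \<Longrightarrow> degree (F i) = i \<and> F i \<noteq> 0"
    "\<And>i w. i \<le> d \<Longrightarrow> w < n \<Longrightarrow> papp (F i) (std_basis u) w \<noteq> 0 \<Longrightarrow> dst u w = i \<and> dst v w = d - i"
    by metis
  define X where "X i = papp (F i) (std_basis u)" for i
  have expand: "\<exists>b. \<forall>w<n. papp p (std_basis u) w = b (dst u w) * X (dst u w) w" for p
  proof -
    \<comment> \<open>Interpolation replaces \<open>p\<close> by a polynomial of degree at most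
      \<open>d\<close> with the same values on the spectrum, to which \<open>shell_expansion\<close>
      applies.\<close>
    define q where "q = (\<Sum>r\<in>{0..d}. Polynomial.smult (poly p (\<theta> r)) (lagrange r))"
    have pq: "papp p (std_basis u) = papp q (std_basis u)"
      by (rule papp_e_cong) (use sum_lag(3)[of _ "\<lambda>r. poly p (\<theta> r)"] u in \<open>auto simp: q_def\<close>)
    have "degree q \<le> d" unfolding q_def by (rule sum_lag(1))
    then obtain b where b: "q = (\<Sum>i<d + 1. Polynomial.smult (b i) (F i))"
      using shell_expansion[of F "d + 1" q] F(1) by (auto simp: coeff_eq_0)
    have "papp p (std_basis u) w = b (dst u w) * X (dst u w) w" if w: "w < n" for w
    proof -
      have "papp p (std_basis u) w = (\<Sum>i<d + 1. b i * X i w)"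
        unfolding pq by (subst b) (simp only: papp_sum papp_smult X_def)
      also have "\<dots> = (\<Sum>i\<in>{dst u w}. b i * X i w)"
      proof (rule sum.mono_neutral_right)
        show "\<forall>i\<in>{..<d + 1} - {dst u w}. b i * X i w = 0"
        proof
          fix i assume "i \<in> {..<d + 1} - {dst u w}"
          then have "X i w = 0" using F(2)[of i w] w by (fastforce simp: X_def)
          then show "b i * X i w = 0" by simp
        qed
      qed (use gdist_le_diameter[OF u w] in auto)
      finally show ?thesis by simp
    qed
    then show ?thesis by blast
  qed
  \<comment> \<open>This polynomial yields the all-one vector.\<close>
  obtain b where b: "\<And>w. w < n \<Longrightarrow> papp (Polynomial.smult (real n) (lagrange 0)) (std_basis u) w = b (dst u w) * X (dst u w) w"
    using expand by blast
  have one: "b (dst u w) * X (dst u w) w = 1" if "w < n" for w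
    using b[OF that] papp_lag_0[OF u that] n_pos by (simp add: papp_smult)
  show "dst v w = d - dst u w" if "w < n" for w
  proof -
    have "X (dst u w) w \<noteq> 0" using one[OF that] by auto
    then show ?thesis using F(2)[OF gdist_le_diameter[OF u that] that] by (simp add: X_def)
  qed
  show "T (\<lambda>w. if dst u w = i then 1 else 0) x = T (\<lambda>w. if dst u w = i then 1 else 0) x'"
    if x: "x < n" "x' < n" "dst u x = dst u x'"
  proof (cases "i \<le> d")
    case True
    let ?p = "[:0, 1:] * Polynomial.smult (b i) (F i)"
    have ind: "(if dst u w = i then 1 else 0) = papp (Polynomial.smult (b i) (F i)) (std_basis u) w" if "w < n" for w
      using one[OF that] F(2)[OF True that] by (auto simp: papp_smult X_def)
    have "T (\<lambda>w. if dst u w = i then 1 else 0) = T (papp (Polynomial.smult (b i) (F i)) (std_basis u))"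
      by (rule T_cong) (rule ind)
    also have "\<dots> = papp ?p (std_basis u)"
      using papp_linear[of 0] by (simp only: papp_mult) (simp add: fun_eq_iff)
    finally have Tp: "T (\<lambda>w. if dst u w = i then 1 else 0) = papp ?p (std_basis u)" .
    obtain b' where b': "\<And>w. w < n \<Longrightarrow> papp ?p (std_basis u) w = b' (dst u w) * X (dst u w) w"
      using expand by blast
    \<comment> \<open>Cancelling the common coefficient shows that \<open>X\<close> agrees at
      \<open>x\<close> and \<open>x'\<close>, so every vector expanded in it does too.\<close>
    have "b (dst u x) \<noteq> 0" using one[OF x(1)] by auto
    then have "X (dst u x) x = X (dst u x) x'"
      using one[OF x(1)] one[OF x(2)] x(3) mult_left_cancel by metis
    then show ?thesis unfolding Tp b'[OF x(1)] b'[OF x(2)] x(3)[symmetric] by simp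
  next
    case False
    have "T (\<lambda>w. if dst u w = i then 1 else 0) = T (\<lambda>w. 0)"
      by (rule T_cong) (use False gdist_le_diameter[OF u] in auto)
    then show ?thesis by simp
  qed
qed

lemma finite_eigenvalues: "finite (adj_eigenvalues n E)"
  unfolding eigenvalues by simp

lemma is_partition_distance: "is_partition n (distance_partition n E x)"
proof -
  have cover: "w \<in> \<Union> (distance_partition n E x)" if "w < n" for w
  proof
    show "w \<in> {y. y < n \<and> dst x y = dst x w}" using that by simp
    then show "{y. y < n \<and> dst x y = dst x w} \<in> distance_partition n E x"
      unfolding distance_partition_def by blast
  qed
  show ?thesis unfolding is_partition_def
  proof (intro conjI ballI impI)
    show "\<Union> (distance_partition n E x) = {0..<n}"
      using cover by (force simp: distance_partition_def)
  qed (auto simp: distance_partition_def)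
qed

lemma swap_imp_antipodal:
  assumes swap: "papp alt_poly (std_basis u) = std_basis v"
  shows "antipodal n E u v"
proof -
  let ?P = "distance_partition n E u"
  have vw: "dst v w = d - dst u w" "dst u w \<le> d" if "w < n" for w
    using swap_imp_distance_indicators(1)[OF swap that] gdist_le_diameter[OF u that] by auto
  have cls: "{w. w < n \<and> dst u w = i} = {w. w < n \<and> dst v w = d - i}" if "i \<le> d" for i
  proof (rule Collect_cong, rule conj_cong[OF refl])
    fix w assume "w < n"
    then show "dst u w = i \<longleftrightarrow> dst v w = d - i" using vw[of w] that by auto
  qed
  have "?P = distance_partition n E v"
  proof
    show "?P \<subseteq> distance_partition n E v"
    proof
      fix C assume "C \<in> ?P"
      then obtain i where C: "C = {w. w < n \<and> dst u w = i}" "C \<noteq> {}"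
        by (auto simp: distance_partition_def)
      then have "i \<le> d" using vw(2) by auto
      then show "C \<in> distance_partition n E v"
        using C cls unfolding distance_partition_def by blast
    qed
    show "distance_partition n E v \<subseteq> ?P"
    proof
      fix C assume "C \<in> distance_partition n E v"
      then obtain i where C: "C = {w. w < n \<and> dst v w = i}" "C \<noteq> {}"
        by (auto simp: distance_partition_def)
      then have "i \<le> d" using vw by auto
      then have "C = {w. w < n \<and> dst u w = d - i}" using C cls[of "d - i"] by simp
      then show "C \<in> ?P" using C unfolding distance_partition_def by blast
    qed
  qed
  moreover have "pseudo_equitable n E ?P"
    unfolding pseudo_equitable_iff[OF finite_eigenvalues]
  proof (intro conjI ballI is_partition_distance)
    fix C C' x x' assume *: "C \<in> ?P" "C' \<in> ?P" "x \<in> C'" "x' \<in> C'"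
    obtain i where C: "C = {w. w < n \<and> dst u w = i}"
      using * by (auto simp: distance_partition_def)
    have x: "x < n" "x' < n" "dst u x = dst u x'"
      using * by (auto simp: distance_partition_def)
    have "T (\<lambda>i. if i \<in> C then 1 else 0) = T (\<lambda>w. if dst u w = i then 1 else 0)"
      by (rule T_cong) (simp add: C)
    then show "T (\<lambda>i. if i \<in> C then 1 else 0) x = T (\<lambda>i. if i \<in> C then 1 else 0) x'"
      using swap_imp_distance_indicators(2)[OF swap x] by simp
  qed
  moreover have single: "{x} \<in> distance_partition n E x" if "x < n" for x
  proof -
    have "{x} = {w. w < n \<and> dst x w = 0}" using that gdist_eq_0[OF that] by auto
    then show ?thesis unfolding distance_partition_def by blast
  qed
  moreover have "cospectral n E u v"
  proof -
    \<comment> \<open>Write e_v as Q(A)e_u. All polynomials in A commute and Q(A) squares to the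
      identity, so both copies of Q(A) cancel.\<close>
    have "papp p (std_basis u) u = papp p (std_basis v) v" for p
    proof -
      have "papp p (std_basis v) v = dot (papp alt_poly (std_basis u)) (papp p (papp alt_poly (std_basis u)))"
        using dot_e[OF v] by (simp add: swap)
      also have "\<dots> = dot (std_basis u) (papp (alt_poly * (p * alt_poly)) (std_basis u))"
        by (simp only: dot_papp papp_mult)
      also have "papp (alt_poly * (p * alt_poly)) (std_basis u) = papp p (papp alt_poly (papp alt_poly (std_basis u)))"
        by (simp only: papp_mult[symmetric] mult_ac)
      also have "dot (std_basis u) \<dots> = papp p (std_basis u) u" by (simp add: alt_poly_square[OF u] dot_e[OF u])
      finally show ?thesis by simp
    qed
    then show ?thesis unfolding cospectral_def adj_mat_M cospectral_iff_papp[OF u v] by blast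
  qed
  ultimately show ?thesis
    unfolding antipodal_def
  proof (intro conjI exI[of _ ?P])
    show "\<forall>w<n. dst u w \<le> dst u v" using vw(2) uv by simp
    show "{u} \<in> ?P" by (rule single[OF u])
    show "{v} \<in> ?P" using single[OF v] \<open>?P = distance_partition n E v\<close> by simp
  qed (assumption | rule refl)+
qed

section \<open>From antipodality to the swap\<close>

lemma antipodal_imp_distance_indicators:
  assumes "antipodal n E u v"
  shows "{w. w < n \<and> dst u w = d} = {v}"
    and "x < n \<Longrightarrow> x' < n \<Longrightarrow> dst u x = dst u x' \<Longrightarrow> i \<le> d
      \<Longrightarrow> T (\<lambda>w. if dst u w = i then 1 else 0) x = T (\<lambda>w. if dst u w = i then 1 else 0) x'"
proof -
  let ?P = "distance_partition n E u"
  have P: "pseudo_equitable n E ?P" "{v} \<in> ?P" using assms by (auto simp: antipodal_def)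
  obtain j where j: "{v} = {w. w < n \<and> dst u w = j}"
    using P(2) by (auto simp: distance_partition_def)
  then have "dst u v = j" by blast
  then show "{w. w < n \<and> dst u w = d} = {v}" using j uv by simp
  assume x: "x < n" "x' < n" "dst u x = dst u x'" "i \<le> d"
  show "T (\<lambda>w. if dst u w = i then 1 else 0) x = T (\<lambda>w. if dst u w = i then 1 else 0) x'"
  proof -
    let ?C = "{w. w < n \<and> dst u w = i}" and ?C' = "{w. w < n \<and> dst u w = dst u x}"
    obtain w where "w < n" "dst u w = i" using ex_at_distance[OF u v, of i] x(4) uv by auto
    then have C: "?C \<in> ?P" unfolding distance_partition_def by blast
    have C': "?C' \<in> ?P" unfolding distance_partition_def using x(1) by blast
    have "x \<in> ?C'" "x' \<in> ?C'" using x(1,2) x(3)[symmetric] by blast+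
    then have "T (\<lambda>w. if w \<in> ?C then 1 else 0) x = T (\<lambda>w. if w \<in> ?C then 1 else 0) x'"
      using conjunct2[OF P(1)[unfolded pseudo_equitable_iff[OF finite_eigenvalues]],
          rule_format, OF C C'] by blast
    moreover have "T (\<lambda>w. if w \<in> ?C then 1 else 0) = T (\<lambda>w. if dst u w = i then 1 else 0)"
      by (rule T_cong) simp
    ultimately show ?thesis by simp
  qed
qed

text \<open>By equitability, A maps the indicator of class \<open>k\<close> to a combination of
  class indicators of index at most k+1. The coefficient at k+1 is nonzero, so the recursion can be
  solved for the next indicator; the one of class \<open>d\<close> is
  \<open>std_basis v\<close>.\<close>

lemma antipodal_imp_ex_poly:
  assumes "antipodal n E u v"
  obtains g where "papp g (std_basis u) = std_basis v"
proof -
  define ind where "ind i w = (if w < n \<and> dst u w = i then 1 else 0 :: real)" for i w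
  have ind_eq: "T (ind i) = T (\<lambda>w. if dst u w = i then 1 else 0)" for i
    by (rule T_cong) (simp add: ind_def)
  have "\<exists>g. ind i = papp g (std_basis u)" if "i \<le> d" for i
    using that
  proof (induction i rule: less_induct)
    case (less i)
    show ?case
    proof (cases i)
      case 0
      have "ind 0 = papp 1 (std_basis u)" using u gdist_eq_0[OF u] by (auto simp: ind_def std_basis_def fun_eq_iff)
      then show ?thesis using 0 by blast
    next
      case (Suc k)
      have "\<forall>j. \<exists>g. j \<le> k \<longrightarrow> ind j = papp g (std_basis u)" using less Suc by auto
      then obtain g where g: "\<And>j. j \<le> k \<Longrightarrow> ind j = papp (g j) (std_basis u)" by metis
      have "\<forall>j. \<exists>w. j \<le> d \<longrightarrow> w < n \<and> dst u w = j"
        using ex_at_distance[OF u v] uv by metis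
      then obtain rep where rep: "\<And>j. j \<le> d \<Longrightarrow> rep j < n \<and> dst u (rep j) = j" by metis
      \<comment> \<open>The number of neighbours in class \<open>k\<close> of a vertex in class
        \<open>j\<close>, read off at a representative.\<close>
      define \<beta> where "\<beta> j = T (ind k) (rep j)" for j
      have kd: "k \<le> d" "Suc k \<le> d" using less.prems Suc by auto
      have T\<beta>: "T (ind k) w = \<beta> (dst u w)" if w: "w < n" for w
        unfolding \<beta>_def ind_eq
        by (rule antipodal_imp_distance_indicators(2)[OF assms w])
           (use rep[OF gdist_le_diameter[OF u w]] kd in auto)
      have far: "T (ind k) w = 0" if w: "w < n" "Suc k < dst u w" for w
      proof -
        have "\<not> E w y \<or> ind k y = 0" if y: "y < n" for y
        proof (rule ccontr)
          assume "\<not> ?thesis"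
          then have "E w y" "dst u y = k" by (auto simp: ind_def split: if_splits)
          moreover from this have "(y, w) \<in> R" using w(1) y E_sym by (auto simp: edge_rel_def)
          then have "dst y w \<le> 1" using gdist_le[of y w 1] by simp
          ultimately show False using gdist_triangle[OF u w(1) y] w(2) by simp
        qed
        then have "(if E w y then 1 else 0) * ind k y = 0" if "y < n" for y using that by auto
        then have "(\<Sum>y<n. (if E w y then 1 else 0) * ind k y) = 0"
          by (intro sum.neutral ballI) blast
        then show ?thesis by (simp only: T_def if_cancel)
      qed
      have \<beta>_nz: "\<beta> (Suc k) \<noteq> 0"
      proof -
        let ?w = "rep (Suc k)"
        have w: "?w < n" "dst u ?w = Suc k" using rep[OF kd(2)] by auto
        have "(u, ?w) \<in> R ^^ Suc k" using gdist_walk[OF u w(1)] unfolding w(2) .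
        then obtain y where y: "(u, y) \<in> R ^^ k" "(y, ?w) \<in> R" by auto
        then have yn: "y < n" "E ?w y" using E_sym by (auto simp: edge_rel_def)
        have "dst y ?w \<le> 1" using gdist_le[of y ?w 1] y(2) by simp
        then have "dst u y = k"
          using gdist_le[OF y(1)] gdist_triangle[OF u w(1) yn(1)] w(2) by linarith
        then have "1 \<le> (if E ?w y then 1 else 0) * ind k y" using yn by (simp add: ind_def)
        also have "\<dots> \<le> (\<Sum>z<n. (if E ?w z then 1 else 0) * ind k z)"
          by (rule member_le_sum) (use yn in \<open>auto simp: ind_def\<close>)
        finally show ?thesis using w(1) by (simp add: \<beta>_def T_def)
      qed
      have decomp: "T (ind k) w = (\<Sum>j\<le>k. \<beta> j * ind j w) + \<beta> (Suc k) * ind (Suc k) w" for w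
      proof (cases "w < n")
        case True
        have "(\<Sum>j\<le>Suc k. \<beta> j * ind j w) = (\<Sum>j\<le>Suc k. if j = dst u w then \<beta> j else 0)"
          by (rule sum.cong) (use True in \<open>auto simp: ind_def\<close>)
        also have "\<dots> = T (ind k) w"
          using T\<beta>[OF True] far[OF True] by (auto simp: sum.delta not_le)
        finally show ?thesis by simp
      next
        case False
        then show ?thesis by (simp add: T_def ind_def)
      qed
      define h where "h = Polynomial.smult (1 / \<beta> (Suc k))
        ([:0, 1:] * g k - (\<Sum>j\<le>k. Polynomial.smult (\<beta> j) (g j)))"
      have "ind (Suc k) w = papp h (std_basis u) w" for w
      proof -
        have 1: "papp ([:0, 1:] * g k) (std_basis u) w = T (ind k) w"
          unfolding papp_mult g[OF le_refl, symmetric] using papp_linear[of 0 "ind k" w] by simp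
        have 2: "(\<Sum>j\<le>k. \<beta> j * papp (g j) (std_basis u) w) = (\<Sum>j\<le>k. \<beta> j * ind j w)"
          by (rule sum.cong) (auto simp: g)
        have "papp h (std_basis u) w = 1 / \<beta> (Suc k) * (T (ind k) w - (\<Sum>j\<le>k. \<beta> j * ind j w))"
          unfolding h_def papp_smult papp_diff papp_sum 1 2 ..
        then show ?thesis unfolding decomp using \<beta>_nz by simp
      qed
      then show ?thesis unfolding Suc by blast
    qed
  qed
  then obtain g where g: "ind d = papp g (std_basis u)" by blast
  have "ind d w = std_basis v w" for w
    using antipodal_imp_distance_indicators(1)[OF assms] by (auto simp: ind_def std_basis_def)
  then have "papp g (std_basis u) = std_basis v" unfolding g by blast
  then show ?thesis by (rule that)
qed

text \<open>It suffices that the polynomial \<open>g\<close> with g(A)e_u = e_v takes the value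
  (-1)^r at \<open>\<theta> r\<close>. Diagonal entries of E_r determine the value up to sign, and
  the entry at \<open>u\<close> and \<open>v\<close> determines the sign.\<close>

lemma antipodal_imp_swap:
  assumes "antipodal n E u v"
  shows "papp alt_poly (std_basis u) = std_basis v"
proof -
  obtain g where g: "papp g (std_basis u) = std_basis v" using antipodal_imp_ex_poly[OF assms] .
  have "cospectral n E u v" using assms by (simp add: antipodal_def)
  then have cosp: "papp p (std_basis u) u = papp p (std_basis v) v" for p
    unfolding cospectral_def adj_mat_M cospectral_iff_papp[OF u v] by blast
  have "poly g (\<theta> r) = (-1) ^ r" if r: "r \<le> d" for r
  proof -
    let ?L = "papp (lagrange r) (std_basis u)" and ?t = "poly g (\<theta> r)"
    have idem: "papp (lagrange r * lagrange r) (std_basis u) = ?L"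
      by (rule papp_e_cong) (use r poly_lag u in auto)
    \<comment> \<open>\<open>lagrange r\<close> has degree \<open>d\<close>, the distance from
      \<open>u\<close> to \<open>v\<close>, so E_r e_u is nonzero. Its squared norm is the diagonal
      entry of E_r at \<open>u\<close>, which is therefore positive.\<close>
    have "lagrange r \<noteq> 0" using coeff_lagrange[OF r] lag_coeff_nonzero[OF r] by auto
    then obtain w where "?L w \<noteq> 0"
      using papp_e_degree_nonzero[OF u v] degree_lag[OF r] uv by (metis order_refl)
    then have "dot ?L ?L \<noteq> 0" using dot_self_eq_0[OF supp_papp[OF supp_e[OF u]]] by metis
    moreover have "dot ?L ?L = ?L u"
      unfolding dot_papp papp_mult[symmetric] idem by (rule dot_e[OF u])
    ultimately have Lu: "0 < ?L u" using dot_self_nonneg[of ?L] by linarith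
    \<comment> \<open>Cospectrality equates the diagonal entries of E_r at \<open>u\<close> and
      \<open>v\<close>; the latter is \<open>?t * ?t\<close> times the former.\<close>
    have "?L u = dot (papp g (std_basis u)) (papp (lagrange r) (papp g (std_basis u)))"
      unfolding g dot_e[OF v] by (rule cosp)
    also have "\<dots> = dot (std_basis u) (papp (g * (lagrange r * g)) (std_basis u))"
      unfolding dot_papp papp_mult ..
    also have "papp (g * (lagrange r * g)) (std_basis u) = papp (Polynomial.smult (?t * ?t) (lagrange r)) (std_basis u)"
      by (rule papp_e_cong) (use r poly_lag u in auto)
    also have "dot (std_basis u) \<dots> = ?t * ?t * ?L u" unfolding dot_e[OF u] papp_smult ..
    finally have "?t * ?t = 1" using Lu by simp
    then have t: "?t = 1 \<or> ?t = -1" by (metis square_eq_1_iff)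
    \<comment> \<open>The entry at \<open>v\<close> of E_r e_u is \<open>?t\<close> times a positive
      number. It is also \<open>lag_coeff r\<close> times a positive number of walks, so
      \<open>lag_coeff_sign\<close> gives the sign of \<open>?t\<close>.\<close>
    have "?L v = dot (papp g (std_basis u)) ?L" unfolding g dot_e[OF v] ..
    also have "\<dots> = dot (std_basis u) (papp (g * lagrange r) (std_basis u))" unfolding dot_papp papp_mult ..
    also have "papp (g * lagrange r) (std_basis u) = papp (Polynomial.smult ?t (lagrange r)) (std_basis u)"
      by (rule papp_e_cong) (use r poly_lag u in auto)
    also have "dot (std_basis u) \<dots> = ?t * ?L u" unfolding dot_e[OF u] papp_smult ..
    finally have "lag_coeff r * (T ^^ d) (std_basis u) v = ?t * ?L u"
      using papp_uv[of "lagrange r"] degree_lag[OF r] coeff_lagrange[OF r] by simp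
    then have "((-1) ^ r * lag_coeff r) * (T ^^ d) (std_basis u) v = ((-1) ^ r * ?t) * ?L u"
      by (simp only: mult.assoc)
    then have "0 < ((-1) ^ r * ?t) * ?L u"
      using mult_pos_pos[OF lag_coeff_sign[OF r] T_pow_uv_pos] by linarith
    then have "0 < (-1) ^ r * ?t" using Lu by (simp add: zero_less_mult_iff)
    then show ?thesis using t by (auto simp: minus_one_power_iff split: if_splits)
  qed
  then have "papp alt_poly (std_basis u) = papp g (std_basis u)"
    by (intro papp_e_cong u) (simp add: alt_poly_props(3))
  then show ?thesis using g by simp
qed

end

theorem theorem3p7:
  fixes n :: nat and E :: "nat \<Rightarrow> nat \<Rightarrow> bool" and \<theta> :: "nat \<Rightarrow> real" and u v :: nat
  assumes "simple_graph n E" and "connected_graph n E" and "regular_graph n E"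
    and "spectrally_extremal n E"
    and "\<And>r s. r < s \<Longrightarrow> s \<le> diameter n E \<Longrightarrow> \<theta> s < \<theta> r"
    and "adj_eigenvalues n E = \<theta> ` {0..diameter n E}"
    and "u < n" and "v < n" and "gdist n E u v = diameter n E"
  shows "antipodal n E u v \<longleftrightarrow>
    real n * (\<Prod>s\<in>{1..diameter n E}. 1 / (\<theta> 0 - \<theta> s))
    = (\<Sum>r\<in>{0..diameter n E}. (-1) ^ r *
         (\<Prod>s\<in>{0..diameter n E} - {r}. 1 / (\<theta> r - \<theta> s)))"
proof -
  obtain k where "\<And>x. x < n \<Longrightarrow> card {y. y < n \<and> E x y} = k"
    using assms(3) by (auto simp: regular_graph_def)
  then interpret extremal_pair n E k \<theta> u v
    by unfold_locales (use assms in auto)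
  show ?thesis
    unfolding equation_iff_entry entry_iff_swap
    using swap_imp_antipodal antipodal_imp_swap by blast
qed

end
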